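(* Let $\mathcal{H}$ be a graded Hilbert module over a graded $C^*$-algebra $B$ and let $\phi : C_0(\mathbb{R}) \to \mathcal{L}(\mathcal{H})$ be a graded $*$-homomorphism. There is a closed graded $\phi$-invariant Hilbert submodule $\mathcal{H}_\phi$ of $\mathcal{H}$ and a self-adjoint regular operator $D$ on $\mathcal{H}_\phi$ of degree one such that for all $f \in C_0(\mathbb{R})$ we have $\phi(f)x = f(D)x$ for all $x \in \mathcal{H}_\phi$. Moreover, if $\phi$ is strict then $\mathcal{H}_\phi$ is complemented and $\phi(f) = f(D) \in \mathcal{L}(\mathcal{H}_\phi) \subseteq \mathcal{L}(\mathcal{H})$ for all $f\in C_0(\mathbb{R})$. If $\phi$ is nondegenerate then $\mathcal{H} = \mathcal{H}_\phi$. And if $\phi(C_0(\mathbb{R})) \subset \mathcal{K}(\mathcal{H})$ then $D$ has compact resolvents.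
   Context: A graded $C^*$-algebra is a $C^*$-algebra $B$ with a $*$-automorphism $\beta$, $\beta^2=\mathrm{id}$; put $B_n=\{x:\beta(x)=(-1)^n x\}$, $n\in\{0,1\}$. We write $\partial x=n$ for $x\in B_n$. A $*$-homomorphism of graded $C^*$-algebras is graded if it maps degree-$n$ elements to degree-$n$ elements. $C_0(\mathbb{R})$ is graded by $f(t)\mapsto f(-t)$ (even and odd functions). A Hilbert $B$-module $\mathcal{H}$ is graded if there is a Banach space decomposition $\mathcal{H}=\mathcal{H}_0\oplus\mathcal{H}_1$ with $\mathcal{H}_n\cdot B_m\subseteq\mathcal{H}_{n+m}$ and $\langle\mathcal{H}_n,\mathcal{H}_m\rangle\subseteq B_{n+m}$ (mod 2). $\mathcal{L}(\mathcal{H})$ is the $C^*$-algebra of bounded adjointable $B$-linear maps, $\mathcal{K}(\mathcal{H})$ its closed ideal of compact operators; both are graded by $\partial T=m$ if $T(\mathcal{H}_n)\subset\mathcal{H}_{n+m}$. A closed submodule $\mathcal{E}$ is $\phi$-invariant if $\phi(f)\mathcal{E}\subseteq\mathcal{E}$ for all $f$. If $\mathcal{E}$ is complemented, $\mathcal{L}(\mathcal{E})\subseteq\mathcal{L}(\mathcal{H})$ by extending operators by zero on the orthogonal complement. A regular operator on a Hilbert module $\mathcal{E}$ is a densely defined closed module map $D:\mathrm{Domain}(D)\to\mathcal{E}$ such that $D^*$ is densely defined and $1+D^*D$ has dense range. It has degree one if $\partial(Dx)=\partial x+1$ (mod 2) for homogeneous $x\in\mathrm{Domain}(D)$. For self-adjoint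 regular $D$, $f(D)$ denotes the functional calculus; $D$ has compact resolvents if $(D\pm i)^{-1}$ are compact operators on $\mathcal{E}$. A $*$-homomorphism $\phi:A\to\mathcal{L}(\mathcal{H})$ is nondegenerate if $\phi(A)\mathcal{H}$ is dense in $\mathcal{H}$, and strict if $\{\phi(u_n)\}$ is Cauchy in the strict topology of $\mathcal{L}(\mathcal{H})$ for some approximate unit $\{u_n\}$ in $A$. *)

theory Defs
  imports "HOL-Analysis.Analysis"
begin

section \<open>Complex Banach spaces and C*-algebras\<close>

class complex_banach = banach +
  fixes scaleC :: "complex \<Rightarrow> 'a \<Rightarrow> 'a"  (infixr "*\<^sub>C" 75)
  assumes scaleC_add_right: "c *\<^sub>C (x + y) = c *\<^sub>C x + c *\<^sub>C y"
    and scaleC_add_left: "(c + d) *\<^sub>C x = c *\<^sub>C x + d *\<^sub>C x"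
    and scaleC_scaleC: "c *\<^sub>C d *\<^sub>C x = (c * d) *\<^sub>C x"
    and scaleC_of_real: "complex_of_real r *\<^sub>C x = r *\<^sub>R x"
    and norm_scaleC: "norm (c *\<^sub>C x) = norm c * norm x"

text \<open>C*-algebras are not assumed to be unital.\<close>

class cstar_algebra = complex_banach + real_normed_algebra +
  fixes star :: "'a \<Rightarrow> 'a"
  assumes scaleC_mult_left: "(c *\<^sub>C x) * y = c *\<^sub>C (x * y)"
    and scaleC_mult_right: "x * (c *\<^sub>C y) = c *\<^sub>C (x * y)"
    and star_star: "star (star x) = x"
    and star_add: "star (x + y) = star x + star y"
    and star_scaleC: "star (c *\<^sub>C x) = cnj c *\<^sub>C star x"
    and star_mult: "star (x * y) = star y * star x"
    and cstar_identity: "norm (star x * x) = (norm x)\<^sup>2"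

definition csubspace :: "'a::complex_banach set \<Rightarrow> bool" where
  "csubspace S \<longleftrightarrow> 0 \<in> S \<and> (\<forall>x\<in>S. \<forall>y\<in>S. x + y \<in> S) \<and> (\<forall>c. \<forall>x\<in>S. c *\<^sub>C x \<in> S)"

text \<open>Degrees live in the type \<open>2\<close> of integers modulo 2, so that \<open>1 + 1 = 0\<close>.\<close>

locale graded_cstar_algebra =
  fixes \<beta> :: "'b::cstar_algebra \<Rightarrow> 'b"
  assumes \<beta>_add: "\<beta> (x + y) = \<beta> x + \<beta> y"
    and \<beta>_scaleC: "\<beta> (c *\<^sub>C x) = c *\<^sub>C \<beta> x"
    and \<beta>_mult: "\<beta> (x * y) = \<beta> x * \<beta> y"
    and \<beta>_star: "\<beta> (star x) = star (\<beta> x)"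
    and \<beta>_involutive: "\<beta> (\<beta> x) = x"

definition cstar_degree :: "('b::cstar_algebra \<Rightarrow> 'b) \<Rightarrow> 2 \<Rightarrow> 'b set" where
  "cstar_degree \<beta> n = {x. \<beta> x = (if n = 0 then x else - x)}"


section \<open>The algebra of continuous functions on the real line vanishing at infinity\<close>

definition C0 :: "(real \<Rightarrow> complex) set" where
  "C0 = {f. continuous_on UNIV f \<and> (f \<longlongrightarrow> 0) at_infinity}"

definition C0_degree :: "2 \<Rightarrow> (real \<Rightarrow> complex) set" where
  "C0_degree n = {f \<in> C0. \<forall>t. f (- t) = (if n = 0 then f t else - f t)}"

text \<open>
  A net in \<open>C0\<close> is represented by its filter of tails: a net \<open>u\<close> along a filter \<open>G\<close>
  becomes \<open>filtermap u G\<close>. Uniform convergence is convergence in the norm of \<open>C0\<close>.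
\<close>

definition C0_approximate_unit :: "(real \<Rightarrow> complex) filter \<Rightarrow> bool" where
  "C0_approximate_unit F \<longleftrightarrow> F \<noteq> bot \<and>
     (\<forall>\<^sub>F u in F. u \<in> C0 \<and> (\<forall>t. \<exists>r\<in>{0..1}. u t = complex_of_real r)) \<and>
     (\<forall>f\<in>C0. uniform_limit UNIV (\<lambda>u t. u t * f t) f F)"


section \<open>Hilbert modules\<close>

text \<open>Right modules; the inner product is linear in the second variable. Completeness for
  the norm given by the inner product comes from the class \<open>complex_banach\<close>.\<close>

locale hilbert_module =
  fixes act :: "'h::complex_banach \<Rightarrow> 'b::cstar_algebra \<Rightarrow> 'h"  (infixl "\<cdot>" 75)
    and ip :: "'h \<Rightarrow> 'h \<Rightarrow> 'b"  ("\<langle>_, _\<rangle>")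
  assumes act_add_left: "(x + y) \<cdot> b = x \<cdot> b + y \<cdot> b"
    and act_add_right: "x \<cdot> (a + b) = x \<cdot> a + x \<cdot> b"
    and act_mult: "x \<cdot> (a * b) = x \<cdot> a \<cdot> b"
    and act_scaleC_left: "(c *\<^sub>C x) \<cdot> b = c *\<^sub>C (x \<cdot> b)"
    and act_scaleC_right: "x \<cdot> (c *\<^sub>C b) = c *\<^sub>C (x \<cdot> b)"
    and ip_add_right: "\<langle>x, y + z\<rangle> = \<langle>x, y\<rangle> + \<langle>x, z\<rangle>"
    and ip_scaleC_right: "\<langle>x, c *\<^sub>C y\<rangle> = c *\<^sub>C \<langle>x, y\<rangle>"
    and ip_act_right: "\<langle>x, y \<cdot> b\<rangle> = \<langle>x, y\<rangle> * b"
    and ip_star: "star \<langle>x, y\<rangle> = \<langle>y, x\<rangle>"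
    and ip_pos: "\<exists>b. \<langle>x, x\<rangle> = star b * b"
    and norm_eq_ip: "norm x = sqrt (norm \<langle>x, x\<rangle>)"
begin

definition submodule :: "'h set \<Rightarrow> bool" where
  "submodule E \<longleftrightarrow> csubspace E \<and> (\<forall>x\<in>E. \<forall>b. x \<cdot> b \<in> E)"

definition orthogonal_complement :: "'h set \<Rightarrow> 'h set" where
  "orthogonal_complement E = {y. \<forall>x\<in>E. \<langle>x, y\<rangle> = 0}"

definition complemented :: "'h set \<Rightarrow> bool" where
  "complemented E \<longleftrightarrow> (\<forall>x. \<exists>e\<in>E. \<exists>p\<in>orthogonal_complement E. x = e + p)"

text \<open>
  In what follows \<open>E\<close> is a closed submodule, regarded as a Hilbert module in its own right
  (\<open>E = UNIV\<close> gives the whole module). An everywhere defined operator on \<open>E\<close> is a function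
  on the ambient type that takes the value 0 at each point outside \<open>E\<close>; this only makes the
  representation unique, and is unrelated to \<open>extend_by_zero\<close> below.
\<close>

definition adjointable :: "'h set \<Rightarrow> ('h \<Rightarrow> 'h) set" where
  "adjointable E = {T.
     (\<forall>x\<in>E. T x \<in> E) \<and> (\<forall>x. x \<notin> E \<longrightarrow> T x = 0) \<and>
     (\<forall>x\<in>E. \<forall>y\<in>E. T (x + y) = T x + T y) \<and>
     (\<forall>x\<in>E. \<forall>c. T (c *\<^sub>C x) = c *\<^sub>C T x) \<and>
     (\<forall>x\<in>E. \<forall>b. T (x \<cdot> b) = T x \<cdot> b) \<and>
     (\<exists>K. \<forall>x\<in>E. norm (T x) \<le> K * norm x) \<and>
     (\<exists>S. \<forall>y\<in>E. S y \<in> E \<and> (\<forall>x\<in>E. \<langle>T x, y\<rangle> = \<langle>x, S y\<rangle>))}"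

definition adj :: "'h set \<Rightarrow> ('h \<Rightarrow> 'h) \<Rightarrow> 'h \<Rightarrow> 'h" where
  "adj E T y = (if y \<in> E then THE z. z \<in> E \<and> (\<forall>x\<in>E. \<langle>T x, y\<rangle> = \<langle>x, z\<rangle>) else 0)"

definition extend_by_zero :: "'h set \<Rightarrow> ('h \<Rightarrow> 'h) \<Rightarrow> 'h \<Rightarrow> 'h" where
  "extend_by_zero E T x = T (THE e. e \<in> E \<and> x - e \<in> orthogonal_complement E)"

definition finite_rank :: "'h set \<Rightarrow> ('h \<Rightarrow> 'h) set" where
  "finite_rank E = {S. \<exists>(n::nat) u v. (\<forall>i<n. u i \<in> E \<and> v i \<in> E) \<and>
     S = (\<lambda>z. \<Sum>i<n. u i \<cdot> \<langle>v i, z\<rangle>)}"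

definition compact_operators :: "'h set \<Rightarrow> ('h \<Rightarrow> 'h) set" where
  "compact_operators E = {T \<in> adjointable E.
     \<forall>e>0. \<exists>S\<in>finite_rank E. \<forall>z\<in>E. norm (T z - S z) \<le> e * norm z}"

definition C0_star_hom :: "'h set \<Rightarrow> ((real \<Rightarrow> complex) \<Rightarrow> 'h \<Rightarrow> 'h) \<Rightarrow> bool" where
  "C0_star_hom E \<pi> \<longleftrightarrow>
     (\<forall>f\<in>C0. \<pi> f \<in> adjointable E) \<and>
     (\<forall>f\<in>C0. \<forall>g\<in>C0. \<pi> (\<lambda>t. f t + g t) = (\<lambda>x. \<pi> f x + \<pi> g x)) \<and>
     (\<forall>f\<in>C0. \<forall>c. \<pi> (\<lambda>t. c * f t) = (\<lambda>x. c *\<^sub>C \<pi> f x)) \<and>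
     (\<forall>f\<in>C0. \<forall>g\<in>C0. \<pi> (\<lambda>t. f t * g t) = \<pi> f \<circ> \<pi> g) \<and>
     (\<forall>f\<in>C0. \<pi> (\<lambda>t. cnj (f t)) = adj E (\<pi> f))"

text \<open>\<open>\<phi>(A)H\<close> is read as a linear span. The real span is a complex subspace,
  because \<open>\<phi> f x\<close> is complex linear in \<open>f\<close>.\<close>

definition nondegenerate :: "((real \<Rightarrow> complex) \<Rightarrow> 'h \<Rightarrow> 'h) \<Rightarrow> bool" where
  "nondegenerate \<phi> \<longleftrightarrow> closure (span {\<phi> f x |f x. f \<in> C0}) = UNIV"

text \<open>The strict topology is given by the seminorms \<open>norm (T x)\<close> and \<open>norm (T* x)\<close>.\<close>

definition strict :: "((real \<Rightarrow> complex) \<Rightarrow> 'h \<Rightarrow> 'h) \<Rightarrow> bool" where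
  "strict \<phi> \<longleftrightarrow> (\<exists>F. C0_approximate_unit F \<and>
     (\<forall>x. cauchy_filter (filtermap (\<lambda>u. \<phi> u x) F) \<and>
          cauchy_filter (filtermap (\<lambda>u. adj UNIV (\<phi> u) x) F)))"


subsection \<open>Unbounded operators\<close>

text \<open>An unbounded operator \<open>D\<close> on \<open>E\<close> is a partial map with domain \<open>dom D\<close>.\<close>

definition module_map :: "'h set \<Rightarrow> ('h \<rightharpoonup> 'h) \<Rightarrow> bool" where
  "module_map E D \<longleftrightarrow> submodule (dom D) \<and> dom D \<subseteq> E \<and> ran D \<subseteq> E \<and>
     (\<forall>x\<in>dom D. \<forall>y\<in>dom D. the (D (x + y)) = the (D x) + the (D y)) \<and>
     (\<forall>x\<in>dom D. \<forall>c. the (D (c *\<^sub>C x)) = c *\<^sub>C the (D x)) \<and>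
     (\<forall>x\<in>dom D. \<forall>b. the (D (x \<cdot> b)) = the (D x) \<cdot> b)"

definition densely_defined :: "'h set \<Rightarrow> ('h \<rightharpoonup> 'h) \<Rightarrow> bool" where
  "densely_defined E D \<longleftrightarrow> E \<subseteq> closure (dom D)"

definition unbounded_adjoint :: "'h set \<Rightarrow> ('h \<rightharpoonup> 'h) \<Rightarrow> ('h \<rightharpoonup> 'h)" where
  "unbounded_adjoint E D y =
     (if y \<in> E \<and> (\<exists>z\<in>E. \<forall>x\<in>dom D. \<langle>the (D x), y\<rangle> = \<langle>x, z\<rangle>)
      then Some (THE z. z \<in> E \<and> (\<forall>x\<in>dom D. \<langle>the (D x), y\<rangle> = \<langle>x, z\<rangle>))
      else None)"

definition regular :: "'h set \<Rightarrow> ('h \<rightharpoonup> 'h) \<Rightarrow> bool" where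
  "regular E D \<longleftrightarrow> module_map E D \<and> densely_defined E D \<and> closed (Map.graph D) \<and>
     densely_defined E (unbounded_adjoint E D) \<and>
     E \<subseteq> closure {x + z |x y z. D x = Some y \<and> unbounded_adjoint E D y = Some z}"

definition self_adjoint :: "'h set \<Rightarrow> ('h \<rightharpoonup> 'h) \<Rightarrow> bool" where
  "self_adjoint E D \<longleftrightarrow> unbounded_adjoint E D = D"

text \<open>\<open>resolvent E D c\<close> is the inverse of \<open>D + c\<close>; for self-adjoint regular \<open>D\<close> and
  \<open>c = \<i>\<close> or \<open>c = - \<i>\<close>, the map \<open>D + c\<close> is a bijection from \<open>dom D\<close> onto \<open>E\<close>.\<close>

definition resolvent :: "'h set \<Rightarrow> ('h \<rightharpoonup> 'h) \<Rightarrow> complex \<Rightarrow> 'h \<Rightarrow> 'h" where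
  "resolvent E D c y =
     (if y \<in> E then THE x. x \<in> dom D \<and> the (D x) + c *\<^sub>C x = y else 0)"

definition compact_resolvents :: "'h set \<Rightarrow> ('h \<rightharpoonup> 'h) \<Rightarrow> bool" where
  "compact_resolvents E D \<longleftrightarrow>
     resolvent E D \<i> \<in> compact_operators E \<and> resolvent E D (- \<i>) \<in> compact_operators E"

text \<open>
  The functional calculus of a self-adjoint regular operator \<open>D\<close> is the unique
  *-homomorphism from \<open>C0\<close> to the adjointable operators on \<open>E\<close> that maps the functions
  \<open>1 / (t + \<i>)\<close> and \<open>1 / (t - \<i>)\<close> to the inverses of \<open>D + \<i>\<close> and \<open>D - \<i>\<close>. These two
  functions generate \<open>C0\<close> as a C*-algebra.
\<close>

definition is_functional_calculus ::
    "'h set \<Rightarrow> ('h \<rightharpoonup> 'h) \<Rightarrow> ((real \<Rightarrow> complex) \<Rightarrow> 'h \<Rightarrow> 'h) \<Rightarrow> bool" where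
  "is_functional_calculus E D \<pi> \<longleftrightarrow> C0_star_hom E \<pi> \<and>
     \<pi> (\<lambda>t. 1 / (complex_of_real t + \<i>)) = resolvent E D \<i> \<and>
     \<pi> (\<lambda>t. 1 / (complex_of_real t - \<i>)) = resolvent E D (- \<i>)"

definition functional_calculus ::
    "'h set \<Rightarrow> ('h \<rightharpoonup> 'h) \<Rightarrow> (real \<Rightarrow> complex) \<Rightarrow> 'h \<Rightarrow> 'h" where
  "functional_calculus E D f = (THE T. \<exists>\<pi>. is_functional_calculus E D \<pi> \<and> T = \<pi> f)"

end


section \<open>Graded Hilbert modules\<close>

locale graded_hilbert_module = graded_cstar_algebra \<beta> + hilbert_module act ip
  for \<beta> :: "'b::cstar_algebra \<Rightarrow> 'b"
    and act :: "'h::complex_banach \<Rightarrow> 'b \<Rightarrow> 'h"  (infixl "\<cdot>" 75)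
    and ip :: "'h \<Rightarrow> 'h \<Rightarrow> 'b"  ("\<langle>_, _\<rangle>") +
  fixes H :: "2 \<Rightarrow> 'h set"
  assumes closed_H: "closed (H n)"
    and csubspace_H: "csubspace (H n)"
    and H_inter: "H 0 \<inter> H 1 = {0}"
    and H_sum: "\<exists>y\<in>H 0. \<exists>z\<in>H 1. x = y + z"
    and H_act: "x \<in> H n \<Longrightarrow> b \<in> cstar_degree \<beta> m \<Longrightarrow> x \<cdot> b \<in> H (n + m)"
    and H_ip: "x \<in> H n \<Longrightarrow> y \<in> H m \<Longrightarrow> \<langle>x, y\<rangle> \<in> cstar_degree \<beta> (n + m)"

definition graded_subspace :: "(2 \<Rightarrow> 'h::complex_banach set) \<Rightarrow> 'h set \<Rightarrow> bool" where
  "graded_subspace H E \<longleftrightarrow> (\<forall>x\<in>E. \<exists>y\<in>E \<inter> H 0. \<exists>z\<in>E \<inter> H 1. x = y + z)"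

definition graded_map ::
    "(2 \<Rightarrow> 'h::complex_banach set) \<Rightarrow> ((real \<Rightarrow> complex) \<Rightarrow> 'h \<Rightarrow> 'h) \<Rightarrow> bool" where
  "graded_map H \<phi> \<longleftrightarrow> (\<forall>m. \<forall>f\<in>C0_degree m. \<forall>n. \<forall>x\<in>H n. \<phi> f x \<in> H (n + m))"

definition degree_one :: "(2 \<Rightarrow> 'h::complex_banach set) \<Rightarrow> ('h \<rightharpoonup> 'h) \<Rightarrow> bool" where
  "degree_one H D \<longleftrightarrow> (\<forall>n. \<forall>x\<in>dom D \<inter> H n. the (D x) \<in> H (n + 1))"

end

theory Submission
  imports Defs
begin

text \<open>
  The essential submodule \<open>E\<close> consists of the limits of \<open>\<phi>(u\<^sub>n) x\<close>, where
  \<open>u\<^sub>n(t) = n\<^sup>2 / (n\<^sup>2 + t\<^sup>2)\<close> is an even approximate unit. On \<open>E\<close> the operator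
  \<open>R = \<phi>(1 / (t + \<i>))\<close> is injective with dense range, and \<open>D\<close> is the operator with
  \<open>(D + \<i>)\<^bsup>-1\<^esup> = R\<close>; thus \<open>D y = z\<close> means \<open>y = R (z + \<i> y)\<close>, and every property of \<open>D\<close> is an
  identity between rational functions. That \<open>\<phi>\<close> restricted to \<open>E\<close> is the functional calculus
  follows from the Stone-Weierstrass theorem, since \<open>1 / (t \<plusminus> \<i>)\<close> generate \<open>C0\<close>.

  Positivity in C*-algebras is avoided throughout: real functions in \<open>C0\<close>, and self-adjoint
  elements of \<open>B\<close>, are real parts of unitaries in a unitization, and unitaries act
  isometrically by a direct computation. This bounds \<open>\<phi>\<close> and the grading automorphism, hence
  also the projections of a graded module onto its homogeneous parts.
\<close>

section \<open>Complex Banach spaces and C*-algebras\<close>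

lemma scaleC_zero_right [simp]: "c *\<^sub>C (0::'a::complex_banach) = 0"
  using scaleC_add_right[of c 0 0] by simp

lemma scaleC_minus_right: "c *\<^sub>C (- x) = - (c *\<^sub>C (x::'a::complex_banach))"
  using scaleC_add_right[of c x "- x"] by (simp add: eq_neg_iff_add_eq_0 add.commute)

lemma scaleC_diff_right: "c *\<^sub>C (x - y) = c *\<^sub>C x - c *\<^sub>C (y::'a::complex_banach)"
  using scaleC_add_right[of c x "- y"] by (simp add: scaleC_minus_right)

lemma scaleC_zero_left [simp]: "0 *\<^sub>C (x::'a::complex_banach) = 0"
  using scaleC_of_real[of 0 x] by simp

lemma scaleC_one [simp]: "1 *\<^sub>C (x::'a::complex_banach) = x"
  using scaleC_of_real[of 1 x] by simp

lemma scaleC_minus_left: "(- c) *\<^sub>C x = - (c *\<^sub>C (x::'a::complex_banach))"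
  using scaleC_add_left[of c "- c" x] by (simp add: eq_neg_iff_add_eq_0 add.commute)

lemma scaleC_diff_left: "(c - d) *\<^sub>C x = c *\<^sub>C x - d *\<^sub>C (x::'a::complex_banach)"
  using scaleC_add_left[of c "- d" x] by (simp add: scaleC_minus_left)

lemma scaleC_2i: "(2 * \<i>) *\<^sub>C (x::'a::complex_banach) = \<i> *\<^sub>C x + \<i> *\<^sub>C x"
  by (metis mult_2 scaleC_add_left)

lemma scaleC_scaleR: "c *\<^sub>C (r *\<^sub>R x) = r *\<^sub>R (c *\<^sub>C (x::'a::complex_banach))"
  by (metis scaleC_of_real scaleC_scaleC mult.commute)

lemma bounded_linear_scaleC: "bounded_linear (\<lambda>x::'a::complex_banach. c *\<^sub>C x)"
  by (rule bounded_linear_intro[where K = "norm c"])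
    (simp_all add: scaleC_add_right scaleC_scaleR norm_scaleC mult.commute)

lemmas tendsto_scaleC [tendsto_intros] = bounded_linear.tendsto[OF bounded_linear_scaleC]
lemmas scaleC_simps = scaleC_add_right scaleC_add_left scaleC_minus_right scaleC_minus_left
  scaleC_diff_right scaleC_diff_left scaleC_scaleC

lemma csubspace_minus: "csubspace S \<Longrightarrow> x \<in> S \<Longrightarrow> - x \<in> S"
  unfolding csubspace_def by (metis scaleC_minus_left scaleC_one)

lemma csubspace_diff: "csubspace S \<Longrightarrow> x \<in> S \<Longrightarrow> y \<in> S \<Longrightarrow> x - y \<in> S"
  using csubspace_minus[of S y] unfolding csubspace_def by (metis diff_conv_add_uminus)

lemma csubspace_subspace: "csubspace S \<Longrightarrow> subspace S"
  unfolding csubspace_def subspace_def by (metis scaleC_of_real)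

section \<open>The involution, unitary dilations and bounds for the grading automorphism\<close>

lemma star_zero [simp]: "star (0::'b::cstar_algebra) = 0"
  using star_add[of 0 "0::'b"] by simp

lemma star_minus: "star (- x) = - star (x::'b::cstar_algebra)"
  using star_scaleC[of "-1" x] by (simp add: scaleC_minus_left)

text \<open>The C*-identity and submultiplicativity give \<open>norm y \<le> norm (star y)\<close>;
  the reverse inequality is the same bound for \<open>star y\<close>.\<close>

lemma norm_star [simp]: "norm (star x) = norm (x::'b::cstar_algebra)"
proof -
  have "norm y \<le> norm (star y)" for y :: 'b
  proof (cases "y = 0")
    case False
    have "norm y * norm y \<le> norm (star y) * norm y"
      using norm_mult_ineq[of "star y" y] by (simp add: cstar_identity power2_eq_square)
    with False show ?thesis by simp
  qed simp
  from this[of x] this[of "star x"] show ?thesis by (simp add: star_star)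
qed

lemma bounded_linear_star: "bounded_linear (star :: 'b::cstar_algebra \<Rightarrow> 'b)"
proof (rule bounded_linear_intro[where K = 1])
  show "star (r *\<^sub>R x) = r *\<^sub>R star x" for r and x :: 'b
    using star_scaleC[of "complex_of_real r" x] by (simp add: scaleC_of_real)
qed (simp_all add: star_add)

text \<open>With \<open>b\<close> as below, \<open>a + \<i>(1 + b)\<close> is a unitary in the unitization.\<close>

lemma ex_unitary_dilation:
  fixes a :: "'b::cstar_algebra"
  assumes a: "star a = a" and na: "norm a \<le> 1 / 2"
  shows "\<exists>b. star b = b \<and> a * b = b * a \<and> a * a + b * b + b + b = 0"
proof -
  \<comment> \<open>The quadratic relation, solved for its linear term, is the fixed point equation
    \<open>T b = b\<close>. It is solved by contraction on the ball of radius 1/2, intersected with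
    the closed conditions of self-adjointness and commutation with \<open>a\<close>.\<close>
  define S where "S = {b::'b. norm b \<le> 1 / 2 \<and> star b = b \<and> a * b = b * a}"
  define T where "T b = (- 1 / 2) *\<^sub>R (a * a + b * b)" for b :: 'b
  have "closed S"
    unfolding S_def
    by (intro closed_Collect_conj closed_Collect_le closed_Collect_eq continuous_intros
        linear_continuous_on bounded_linear_star)
  then have S: "complete S" by (rule complete_eq_closed[THEN iffD2])
  have "S \<noteq> {}" unfolding S_def by (auto intro!: exI[of _ 0])
  moreover have "T ` S \<subseteq> S"
  proof (rule image_subsetI)
    fix b assume b: "b \<in> S"
    have "norm (a * a + b * b) \<le> norm a * norm a + norm b * norm b"
      by (meson add_mono norm_mult_ineq norm_triangle_le)
    also have "\<dots> \<le> 1 / 2 * (1 / 2) + 1 / 2 * (1 / 2)"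
      using b na by (intro add_mono mult_mono) (auto simp: S_def)
    finally have "norm (T b) \<le> 1 / 2" by (simp add: T_def)
    moreover have "star (T b) = T b"
      using b a unfolding T_def S_def
      by (simp add: bounded_linear.linear[OF bounded_linear_star, THEN linear_scale]
          star_add star_mult star_minus)
    moreover have "a * T b = T b * a"
      using b unfolding T_def S_def by (simp add: algebra_simps) (metis mult.assoc)
    ultimately show "T b \<in> S" by (simp add: S_def)
  qed
  moreover have "dist (T b) (T c) \<le> 1 / 2 * dist b c" if "b \<in> S" "c \<in> S" for b c
  proof -
    \<comment> \<open>This factorization of a difference of squares is valid for noncommuting
      \<open>b\<close> and \<open>c\<close>. Since both norms are at most 1/2, the contraction
      constant is 1/2.\<close>
    have "T b - T c = (- 1 / 2) *\<^sub>R (b * (b - c) + (b - c) * c)"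
      by (simp add: T_def algebra_simps)
    then have "norm (T b - T c) = 1 / 2 * norm (b * (b - c) + (b - c) * c)"
      by (simp only: norm_scaleR)
    also have "\<dots> \<le> 1 / 2 * (norm b * norm (b - c) + norm (b - c) * norm c)"
      by (intro mult_left_mono) (auto intro: order_trans[OF norm_triangle_ineq] add_mono norm_mult_ineq)
    also have "\<dots> = 1 / 2 * ((norm b + norm c) * norm (b - c))" by (simp add: algebra_simps)
    also have "\<dots> \<le> 1 / 2 * (1 * norm (b - c))"
      using that by (intro mult_left_mono mult_right_mono) (auto simp: S_def)
    finally show ?thesis by (simp add: dist_norm)
  qed
  ultimately have "\<exists>!x. x \<in> S \<and> T x = x"
    using S by (intro Banach_fix[where c = "1/2"]) auto
  then obtain b where b: "b \<in> S" "T b = b" by auto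
  have "a * a + b * b + b + b = (- 2) *\<^sub>R T b + 2 *\<^sub>R b"
    by (simp add: T_def scaleR_2 add.assoc)
  with b show ?thesis unfolding S_def by auto
qed

text \<open>A dilation of \<open>a\<close> is given by algebraic relations, which
  \<open>\<beta>\<close> carries over to \<open>\<beta> a\<close>. So the image of the ball of
  radius 1/2 lies in the unit ball, and rescaling gives the factor 2.\<close>

lemma (in graded_cstar_algebra) norm_\<beta>_self_adjoint_le:
  assumes a: "star a = a"
  shows "norm (\<beta> a) \<le> 2 * norm a"
proof -
  have minus: "\<beta> (- x) = - \<beta> x" for x
    using \<beta>_scaleC[of "-1" x] by (simp add: scaleC_minus_left)
  have zero: "\<beta> 0 = 0" using \<beta>_add[of 0 0] by simp
  have *: "norm (\<beta> a) \<le> 1" if a: "star a = a" and na: "norm a \<le> 1 / 2" for a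
  proof -
    obtain b where b: "star b = b" "a * b = b * a" "a * a + b * b + b + b = 0"
      using ex_unitary_dilation[OF a na] by auto
    define a' b' where "a' = \<beta> a" and "b' = \<beta> b"
    have sa: "star a' = a'" "star b' = b'" unfolding a'_def b'_def by (metis \<beta>_star a b(1))+
    have comm: "a' * b' = b' * a'" unfolding a'_def b'_def by (metis \<beta>_mult b(2))
    have rel: "a' * a' + b' * b' + b' + b' = 0"
      unfolding a'_def b'_def by (metis \<beta>_mult \<beta>_add b(3) zero)
    \<comment> \<open>Left multiplication by the unitary \<open>a' + c (1 + b')\<close> is isometric
      for both choices of \<open>c\<close>; distributing over \<open>x\<close> avoids a
      unit.\<close>
    have isom: "norm (a' * x + c *\<^sub>C (x + b' * x)) = norm x" if c: "c = \<i> \<or> c = - \<i>" for c x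
    proof -
      have cc: "c * c = - 1" "cnj c = - c" using c by auto
      have e: "star (a' * x + c *\<^sub>C (x + b' * x)) = star x * a' + cnj c *\<^sub>C (star x + star x * b')"
        by (simp add: star_add star_mult star_scaleC sa)
      have "star (a' * x + c *\<^sub>C (x + b' * x)) * (a' * x + c *\<^sub>C (x + b' * x))
        = star x * x + star x * ((a' * a' + b' * b' + b' + b') * x)
          + c *\<^sub>C (star x * ((a' * b' - b' * a') * x))"
        unfolding e using cc
        by (simp add: algebra_simps scaleC_mult_left scaleC_mult_right scaleC_simps cc)
      also have "\<dots> = star x * x" by (simp add: rel comm)
      finally show ?thesis
        by (metis cstar_identity norm_ge_zero power2_eq_imp_eq)
    qed
    \<comment> \<open>The sum of the two isometries is twice left multiplication by
      \<open>a'\<close>. It is evaluated at \<open>a'\<close> itself, where the C*-identity turns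
      the estimate into a bound for \<open>norm a'\<close>.\<close>
    have "2 *\<^sub>R (a' * a') = (a' * a' + \<i> *\<^sub>C (a' + b' * a')) + (a' * a' + (- \<i>) *\<^sub>C (a' + b' * a'))"
      by (simp add: scaleC_minus_left scaleR_2)
    then have "norm (2 *\<^sub>R (a' * a')) \<le> norm a' + norm a'"
      using isom[of \<i> a'] isom[of "- \<i>" a'] by (metis norm_triangle_ineq)
    then have "norm (a' * a') \<le> norm a'" by simp
    then have "norm a' * norm a' \<le> norm a'"
      using cstar_identity[of a'] by (simp add: sa power2_eq_square)
    then have "norm a' \<le> 1" by (cases "a' = 0") auto
    then show ?thesis by (simp add: a'_def)
  qed
  show ?thesis
  proof (cases "a = 0")
    case False
    \<comment> \<open>The scaling brings the norm down to 1/2, the radius for which dilations are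
      available.\<close>
    define s where "s = 1 / (2 * norm a)"
    have s: "s > 0" using False by (simp add: s_def)
    have "norm (\<beta> (s *\<^sub>R a)) \<le> 1"
    proof (rule *)
      show "star (s *\<^sub>R a) = s *\<^sub>R a"
        by (simp add: bounded_linear.linear[OF bounded_linear_star, THEN linear_scale] a)
    qed (use False in \<open>simp add: s_def\<close>)
    moreover have "\<beta> (s *\<^sub>R a) = s *\<^sub>R \<beta> a" by (metis \<beta>_scaleC scaleC_of_real)
    ultimately have "s * norm (\<beta> a) \<le> 1" using s by simp
    then show ?thesis using False by (simp add: s_def field_simps)
  qed (simp add: zero)
qed

section \<open>Continuous functions vanishing at infinity\<close>

lemma C0_mult:
  assumes "f \<in> C0" "g \<in> C0" shows "(\<lambda>t. f t * g t) \<in> C0"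
  using assms tendsto_mult[of f 0 at_infinity g 0] by (auto simp: C0_def intro!: continuous_on_mult)

lemma C0_add:
  assumes "f \<in> C0" "g \<in> C0" shows "(\<lambda>t. f t + g t) \<in> C0"
  using assms tendsto_add[of f 0 at_infinity g 0] by (auto simp: C0_def intro!: continuous_on_add)

lemma C0_cmult:
  assumes "f \<in> C0" shows "(\<lambda>t. c * f t) \<in> C0"
  using assms tendsto_mult_left[of f 0 at_infinity c] by (auto simp: C0_def intro!: continuous_intros)

lemma C0_minus: "f \<in> C0 \<Longrightarrow> (\<lambda>t. - f t) \<in> C0"
  using C0_cmult[of f "- 1"] by simp

lemma C0_diff: "f \<in> C0 \<Longrightarrow> g \<in> C0 \<Longrightarrow> (\<lambda>t. f t - g t) \<in> C0"
  using C0_add[of f "\<lambda>t. - g t"] C0_minus[of g] by simp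

lemma C0_cnj: "f \<in> C0 \<Longrightarrow> (\<lambda>t. cnj (f t)) \<in> C0"
  using tendsto_cnj[of f 0 at_infinity] by (auto simp: C0_def intro!: continuous_intros)

lemma C0_compose:
  assumes f: "f \<in> C0" and g: "continuous_on UNIV g" "g 0 = 0"
  shows "(\<lambda>t. g (f t)) \<in> C0"
proof -
  have "continuous_on UNIV (\<lambda>t. g (f t))"
    using f by (intro continuous_on_compose2[OF g(1)]) (auto simp: C0_def)
  moreover have "((\<lambda>t. g (f t)) \<longlongrightarrow> g 0) at_infinity"
    using f g by (intro continuous_on_tendsto_compose[OF g(1)]) (auto simp: C0_def)
  ultimately show ?thesis using g by (simp add: C0_def)
qed

lemma C0_Re: "f \<in> C0 \<Longrightarrow> (\<lambda>t. complex_of_real (Re (f t))) \<in> C0"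
  by (rule C0_compose[where g = "\<lambda>z. complex_of_real (Re z)"]) (simp_all add: continuous_on_of_real continuous_on_Re)

lemma C0_Im: "f \<in> C0 \<Longrightarrow> (\<lambda>t. complex_of_real (Im (f t))) \<in> C0"
  by (rule C0_compose[where g = "\<lambda>z. complex_of_real (Im z)"]) (simp_all add: continuous_on_of_real continuous_on_Im)

lemma C0I:
  fixes f :: "real \<Rightarrow> complex"
  assumes "continuous_on UNIV f" and C: "\<And>t. norm (f t) * \<bar>t\<bar> \<le> C"
  shows "f \<in> C0"
proof -
  have "(f \<longlongrightarrow> 0) at_infinity"
  proof (rule Lim_null_comparison)
    show "\<forall>\<^sub>F t in at_infinity. norm (f t) \<le> C * \<bar>inverse t\<bar>"
      using eventually_not_equal_at_infinity[of "0::real"]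
    proof eventually_elim
      case (elim t)
      then show ?case using C[of t] by (simp add: field_simps)
    qed
    have "((\<lambda>t::real. C * \<bar>inverse t\<bar>) \<longlongrightarrow> C * \<bar>0\<bar>) at_infinity"
      by (intro tendsto_intros tendsto_inverse_0)
    then show "((\<lambda>t::real. C * \<bar>inverse t\<bar>) \<longlongrightarrow> 0) at_infinity" by simp
  qed
  with assms show ?thesis by (simp add: C0_def)
qed

lemma C0_bounded:
  assumes "f \<in> C0" shows "\<exists>C. \<forall>t. norm (f t) \<le> C"
proof -
  have "\<forall>\<^sub>F t in at_infinity. norm (f t) < 1"
    using assms order_tendstoD(2)[of "\<lambda>t. norm (f t)" 0 at_infinity 1]
    by (auto simp: C0_def dest: tendsto_norm_zero)
  then obtain b where b: "\<And>t. \<bar>t\<bar> \<ge> b \<Longrightarrow> norm (f t) < 1"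
    by (auto simp: eventually_at_infinity)
  have "compact (f ` {-b..b})"
    using assms by (intro compact_continuous_image) (auto simp: C0_def intro: continuous_on_subset)
  then obtain K where K: "\<And>t. t \<in> {-b..b} \<Longrightarrow> norm (f t) \<le> K"
    by (meson bounded_iff compact_imp_bounded image_eqI)
  have "norm (f t) \<le> max 1 K" for t
    using b[of t] K[of t] by (cases "\<bar>t\<bar> \<ge> b") (auto simp: abs_if split: if_splits)
  then show ?thesis by blast
qed

section \<open>The resolvent function and an even approximate unit\<close>

definition res :: "real \<Rightarrow> complex" where
  "res t = 1 / (complex_of_real t + \<i>)"

lemma of_real_plus_i_nonzero [simp]:
  "complex_of_real t + \<i> \<noteq> 0" "complex_of_real t - \<i> \<noteq> 0"
  by (auto simp: complex_eq_iff)

lemma cnj_res: "cnj (res t) = 1 / (complex_of_real t - \<i>)"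
  by (simp add: res_def)

lemma res_C0: "res \<in> C0"
proof (rule C0I[where C = 1])
  show "continuous_on UNIV res" unfolding res_def by (intro continuous_intros) auto
  show "norm (res t) * \<bar>t\<bar> \<le> 1" for t
  proof -
    have "\<bar>t\<bar> \<le> norm (complex_of_real t + \<i>)"
      using abs_Re_le_cmod[of "complex_of_real t + \<i>"] by simp
    then show ?thesis by (simp add: res_def norm_divide divide_le_eq)
  qed
qed

lemma cnj_res_C0: "(\<lambda>t. cnj (res t)) \<in> C0"
  by (rule C0_cnj[OF res_C0])

text \<open>With \<open>R\<close> the inverse of \<open>D + \<i>\<close>, this is the functional
  form of \<open>D R = 1 - \<i> R\<close>.\<close>

lemma mult_res: "complex_of_real t * res t = 1 - \<i> * res t"
  using of_real_plus_i_nonzero(1)[of t] by (simp add: res_def field_simps)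

text \<open>The first resolvent identity for the points \<open>\<i>\<close> and
  \<open>- \<i>\<close>.\<close>

lemma cnj_res_mult_res: "2 * \<i> * (cnj (res t) * res t) = cnj (res t) - res t"
  using of_real_plus_i_nonzero[of t] unfolding cnj_res by (simp add: res_def field_simps)

text \<open>Decay of order two leaves room for one multiplication by \<open>t\<close> inside
  \<open>C0\<close>. The successor keeps the denominator positive at \<open>t = 0\<close> for index
  0 as well.\<close>

definition plateau :: "nat \<Rightarrow> real \<Rightarrow> complex" where
  "plateau n t = complex_of_real ((real (Suc n))\<^sup>2 / ((real (Suc n))\<^sup>2 + t\<^sup>2))"

lemma plateau_pos: "(real (Suc n))\<^sup>2 + t\<^sup>2 > 0"
  by (intro add_pos_nonneg) auto

lemma plateau_cnj [simp]: "cnj (plateau n t) = plateau n t"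
  by (simp add: plateau_def)

lemma plateau_even: "plateau n (- t) = plateau n t"
  by (simp add: plateau_def)

lemma norm_plateau_le: "norm (plateau n t) \<le> 1"
  using plateau_pos[of n t] unfolding plateau_def norm_of_real by (simp add: abs_of_pos)

lemma continuous_on_plateau: "continuous_on S (plateau n)"
  unfolding plateau_def using plateau_pos[of n]
  by (intro continuous_intros) (metis less_irrefl)

lemma plateau_mult_C0: "(\<lambda>t. complex_of_real t * plateau n t) \<in> C0"
proof (rule C0I)
  show "continuous_on UNIV (\<lambda>t. complex_of_real t * plateau n t)"
    by (intro continuous_intros continuous_on_plateau)
  show "norm (complex_of_real t * plateau n t) * \<bar>t\<bar> \<le> (real (Suc n))\<^sup>2" for t
  proof -
    have "norm (complex_of_real t * plateau n t) * \<bar>t\<bar> = (real (Suc n))\<^sup>2 * t\<^sup>2 / ((real (Suc n))\<^sup>2 + t\<^sup>2)"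
      using plateau_pos[of n t] unfolding plateau_def norm_mult norm_of_real
      by (simp add: abs_of_pos power2_eq_square)
    also have "\<dots> \<le> (real (Suc n))\<^sup>2"
      using plateau_pos[of n t] by (simp add: divide_le_eq algebra_simps)
    finally show ?thesis .
  qed
qed

lemma plateau_C0: "plateau n \<in> C0"
proof -
  have "norm (plateau n t) * \<bar>t\<bar> \<le> (real (Suc n))\<^sup>2" for t
  proof -
    have "\<bar>t\<bar> \<le> (real (Suc n))\<^sup>2 + t\<^sup>2"
    proof (cases "\<bar>t\<bar> \<le> 1")
      case True
      have "1 \<le> (real (Suc n))\<^sup>2" by simp
      with True show ?thesis by (meson add_increasing2 order_trans zero_le_power2)
    next
      case False
      then have "\<bar>t\<bar> * 1 \<le> \<bar>t\<bar> * \<bar>t\<bar>" by (intro mult_left_mono) auto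
      then show ?thesis by (simp add: power2_eq_square add_increasing)
    qed
    then have "(real (Suc n))\<^sup>2 * \<bar>t\<bar> / ((real (Suc n))\<^sup>2 + t\<^sup>2) \<le> (real (Suc n))\<^sup>2"
      using plateau_pos[of n t] by (subst pos_divide_le_eq) auto
    then show ?thesis
      using plateau_pos[of n t] unfolding plateau_def norm_of_real by (simp add: abs_of_pos)
  qed
  then show ?thesis by (intro C0I[where C = "(real (Suc n))\<^sup>2"] continuous_on_plateau)
qed

text \<open>Outside \<open>[-M, M]\<close> the factor \<open>1 - plateau n\<close> is at most 1 and
  \<open>f\<close> is small; inside, the factor is at most
  \<open>M\<^sup>2 / (Suc n)\<^sup>2\<close> and \<open>f\<close> is bounded.\<close>

lemma uniform_limit_plateau:
  assumes f: "f \<in> C0"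
  shows "uniform_limit UNIV (\<lambda>n t. plateau n t * f t) f sequentially"
proof (rule uniform_limitI)
  fix e :: real assume e: "e > 0"
  obtain K where K: "\<And>t. norm (f t) \<le> K" using C0_bounded[OF f] by auto
  have K0: "K \<ge> 0" using K[of 0] norm_ge_zero order_trans by blast
  have "\<forall>\<^sub>F t in at_infinity. norm (f t) < e"
    using f e order_tendstoD(2)[of "\<lambda>t. norm (f t)" 0 at_infinity e]
    by (auto simp: C0_def dest: tendsto_norm_zero)
  then obtain M where M: "\<And>t. \<bar>t\<bar> \<ge> M \<Longrightarrow> norm (f t) < e"
    by (auto simp: eventually_at_infinity)
  have "(\<lambda>n. M\<^sup>2 * K * inverse (real (Suc n)) * inverse (real (Suc n))) \<longlonglongrightarrow> M\<^sup>2 * K * 0 * 0"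
    by (intro tendsto_intros LIMSEQ_inverse_real_of_nat)
  then have "\<forall>\<^sub>F n in sequentially. M\<^sup>2 * K * inverse (real (Suc n)) * inverse (real (Suc n)) < e"
    using e by (intro order_tendstoD) auto
  then show "\<forall>\<^sub>F n in sequentially. \<forall>t\<in>UNIV. dist (plateau n t * f t) (f t) < e"
  proof eventually_elim
    case (elim n)
    show ?case
    proof
      fix t :: real
      define N where "N = real (Suc n)"
      have N: "N > 0" by (simp add: N_def)
      have pos: "N\<^sup>2 + t\<^sup>2 > 0" using N by (simp add: add_pos_nonneg)
      have "dist (plateau n t * f t) (f t) = norm ((plateau n t - 1) * f t)"
        by (simp add: dist_norm algebra_simps)
      also have "plateau n t - 1 = complex_of_real (- (t\<^sup>2 / (N\<^sup>2 + t\<^sup>2)))"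
      proof -
        have "N\<^sup>2 / (N\<^sup>2 + t\<^sup>2) - 1 = - (t\<^sup>2 / (N\<^sup>2 + t\<^sup>2))"
          using pos N by (simp add: divide_simps)
        then show ?thesis unfolding plateau_def N_def[symmetric] by (metis of_real_1 of_real_diff)
      qed
      also have "norm (\<dots> * f t) = t\<^sup>2 / (N\<^sup>2 + t\<^sup>2) * norm (f t)"
        using pos by (simp only: norm_mult norm_of_real abs_minus_cancel abs_divide) simp
      also have "\<dots> < e"
      proof (cases "\<bar>t\<bar> \<ge> M")
        case True
        have "t\<^sup>2 / (N\<^sup>2 + t\<^sup>2) * norm (f t) \<le> 1 * norm (f t)"
          using pos by (intro mult_right_mono) auto
        with M[OF True] show ?thesis by simp
      next
        case False
        then have "t\<^sup>2 \<le> M\<^sup>2" by (intro abs_le_square_iff[THEN iffD1]) auto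
        then have "t\<^sup>2 / (N\<^sup>2 + t\<^sup>2) \<le> M\<^sup>2 / N\<^sup>2" using N by (intro frac_le) auto
        then have "t\<^sup>2 / (N\<^sup>2 + t\<^sup>2) * norm (f t) \<le> M\<^sup>2 / N\<^sup>2 * K"
          using K by (intro mult_mono) auto
        also have "\<dots> = M\<^sup>2 * K * inverse N * inverse N"
          by (simp add: field_simps power2_eq_square)
        also have "\<dots> < e" using elim by (simp add: N_def)
        finally show ?thesis .
      qed
      finally show "dist (plateau n t * f t) (f t) < e" .
    qed
  qed
qed

text \<open>The range of \<open>res\<close> together with \<open>0\<close> is a circle, a model of the one-point
  compactification of the line to which the Stone-Weierstrass theorem applies.\<close>

lemma C0_generated_by_res:
  assumes add: "\<And>f g. f \<in> A \<Longrightarrow> g \<in> A \<Longrightarrow> (\<lambda>t. f t + g t) \<in> A"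
    and mult: "\<And>f g. f \<in> A \<Longrightarrow> g \<in> A \<Longrightarrow> (\<lambda>t. f t * g t) \<in> A"
    and cmult: "\<And>f c. f \<in> A \<Longrightarrow> (\<lambda>t. c * f t) \<in> A"
    and res: "res \<in> A" "(\<lambda>t. cnj (res t)) \<in> A"
    and lim: "\<And>f. f \<in> C0 \<Longrightarrow> (\<And>e. e > 0 \<Longrightarrow> \<exists>g\<in>A. \<forall>t. norm (f t - g t) < e) \<Longrightarrow> f \<in> A"
  shows "C0 \<subseteq> A"
proof -
  define K where "K = sphere (- \<i> / 2) (1 / 2)"
  have K_iff: "z \<in> K \<longleftrightarrow> (Re z)\<^sup>2 + (Im z)\<^sup>2 + Im z = 0" for z
  proof -
    have "z \<in> K \<longleftrightarrow> (cmod (z + \<i> / 2))\<^sup>2 = (1 / 2)\<^sup>2"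
      unfolding K_def by (subst power2_eq_iff_nonneg) (auto simp: dist_norm norm_minus_commute)
    also have "\<dots> \<longleftrightarrow> (Re z)\<^sup>2 + (Im z)\<^sup>2 + Im z = 0"
      unfolding cmod_power2 by (simp add: power2_eq_square algebra_simps) argo
    finally show ?thesis .
  qed
  have resK: "res t \<in> K" for t
  proof -
    have "res t + \<i> / 2 = (\<i> / 2) * (cnj (complex_of_real t + \<i>) / (complex_of_real t + \<i>))"
    proof -
      define w where "w = complex_of_real t + \<i>"
      have w: "w \<noteq> 0" "cnj w = w - 2 * \<i>" "res t = 1 / w" by (simp_all add: w_def res_def)
      show ?thesis unfolding w_def[symmetric] w(2,3) using w(1) by (simp add: field_simps)
    qed
    then have "norm (res t + \<i> / 2) = 1 / 2 * (norm (cnj (complex_of_real t + \<i>)) / norm (complex_of_real t + \<i>))"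
      by (simp only: norm_mult norm_divide) simp
    then show ?thesis
      by (simp only: complex_mod_cnj) (simp add: K_def dist_norm norm_minus_commute)
  qed
  have zK: "0 \<in> K" by (simp add: K_iff)
  \<comment> \<open>On the circle without 0, \<open>1 / z\<close> has imaginary part 1, so
    \<open>Re (1 / z)\<close> is the parameter of \<open>z\<close> on the line.\<close>
  have res_inv: "res (Re (1 / z)) = z" if "z \<in> K" "z \<noteq> 0" for z
  proof -
    have "(Re z)\<^sup>2 + (Im z)\<^sup>2 \<noteq> 0" using that(2) by (simp add: complex_eq_iff)
    moreover have "- Im z = (Re z)\<^sup>2 + (Im z)\<^sup>2" using that(1) by (simp add: K_iff)
    ultimately have "Im (1 / z) = 1" by (simp add: Im_divide)
    then have "complex_of_real (Re (1 / z)) + \<i> = 1 / z" by (simp add: complex_eq_iff)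
    then show ?thesis using that(2) by (simp add: res_def)
  qed
  have Re_inv: "Re (1 / res t) = t" for t by (simp add: res_def)
  \<comment> \<open>The ring consists of real functions on the circle. Their value at 0, the point
    at infinity, is subtracted so that constants qualify: they yield the zero function.\<close>
  define R where "R = {F. continuous_on K F \<and> (\<lambda>t. complex_of_real (F (res t) - F 0)) \<in> A}"
  have R: "function_ring_on R K"
  proof
    show "compact K" by (simp add: K_def)
    show "continuous_on K F" if "F \<in> R" for F using that by (simp add: R_def)
    show "(\<lambda>z. F z + G z) \<in> R" if "F \<in> R" "G \<in> R" for F G
      using that add[of "\<lambda>t. complex_of_real (F (res t) - F 0)" "\<lambda>t. complex_of_real (G (res t) - G 0)"]
      by (auto simp: R_def algebra_simps intro!: continuous_intros)
    show "(\<lambda>z. F z * G z) \<in> R" if FG: "F \<in> R" "G \<in> R" for F G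
    proof -
      let ?F = "\<lambda>t. complex_of_real (F (res t) - F 0)" and ?G = "\<lambda>t. complex_of_real (G (res t) - G 0)"
      have "?F \<in> A" "?G \<in> A" using FG by (auto simp: R_def)
      \<comment> \<open>The difference of products is a polynomial without constant term in the two
        differences, hence stays in \<open>A\<close>.\<close>
      then have "(\<lambda>t. ?F t * ?G t + (complex_of_real (F 0) * ?G t + complex_of_real (G 0) * ?F t)) \<in> A"
        by (intro add mult cmult)
      also have "(\<lambda>t. ?F t * ?G t + (complex_of_real (F 0) * ?G t + complex_of_real (G 0) * ?F t))
        = (\<lambda>t. complex_of_real (F (res t) * G (res t) - F 0 * G 0))"
        by (auto simp: algebra_simps)
      finally show ?thesis using FG by (auto simp: R_def intro!: continuous_intros)
    qed
    show "(\<lambda>_. c) \<in> R" for c using cmult[OF res(1), of 0] by (simp add: R_def)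
    have "(\<lambda>t. 1 / 2 * (res t + cnj (res t))) \<in> A" by (intro cmult add res)
    also have "(\<lambda>t. 1 / 2 * (res t + cnj (res t))) = (\<lambda>t. complex_of_real (Re (res t)))"
      by (simp add: complex_add_cnj)
    finally have "Re \<in> R" by (simp add: R_def continuous_intros)
    have "(\<lambda>t. (- \<i> / 2) * (res t + (- 1) * cnj (res t))) \<in> A" by (intro cmult add res)
    also have "(\<lambda>t. (- \<i> / 2) * (res t + (- 1) * cnj (res t))) = (\<lambda>t. complex_of_real (Im (res t)))"
      by (auto simp: complex_eq_iff)
    finally have "Im \<in> R" by (simp add: R_def continuous_intros)
    with \<open>Re \<in> R\<close> show "\<exists>F\<in>R. F z \<noteq> F w" if "z \<noteq> w" for z w
      using that complex_eq_iff by blast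
  qed
  have real: "(\<lambda>t. complex_of_real (h t)) \<in> A" if h: "(\<lambda>t. complex_of_real (h t)) \<in> C0" for h
  proof (rule lim[OF h])
    fix e :: real assume e: "e > 0"
    have hc: "continuous_on UNIV h"
      using h continuous_on_Re[of UNIV "\<lambda>t. complex_of_real (h t)"] by (simp add: C0_def)
    have h0: "(h \<longlongrightarrow> 0) at_infinity"
      using h tendsto_Re[of "\<lambda>t. complex_of_real (h t)" 0 at_infinity] by (simp add: C0_def)
    \<comment> \<open>This transports \<open>h\<close> to the circle, with its limit at infinity as
      the value at 0. Continuity at 0 expresses the decay of \<open>h\<close>.\<close>
    define F where "F z = (if z = 0 then 0 else h (Re (1 / z)))" for z :: complex
    have "continuous (at z within K) F" if z: "z \<in> K" for z
    proof (cases "z = 0")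
      case False
      have "isCont h (Re (1 / z))" using hc by (simp add: continuous_on_eq_continuous_at)
      then have "isCont (\<lambda>z. h (Re (1 / z))) z"
        using False by (intro isCont_o2[of z "\<lambda>z. Re (1 / z)" h]) (simp_all add: continuous_intros)
      moreover have "\<forall>\<^sub>F w in nhds z. w \<noteq> 0" using False by (rule t1_space_nhds)
      then have "\<forall>\<^sub>F w in nhds z. F w = h (Re (1 / w))" by eventually_elim (simp add: F_def)
      ultimately have "isCont F z" by (simp add: isCont_cong)
      then show ?thesis by (rule continuous_at_imp_continuous_at_within)
    next
      case True
      have "(F \<longlongrightarrow> 0) (at 0 within K)"
      proof (rule tendstoI)
        fix d :: real assume d: "d > 0"
        obtain b where b: "\<And>t. \<bar>t\<bar> \<ge> b \<Longrightarrow> \<bar>h t\<bar> < d"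
          using tendstoD[OF h0 d] by (auto simp: eventually_at_infinity)
        show "\<forall>\<^sub>F z in at 0 within K. dist (F z) 0 < d"
          unfolding eventually_at
        proof (intro exI conjI ballI impI)
          show "1 / (\<bar>b\<bar> + 1) > 0" by (simp add: add_nonneg_pos)
          fix z assume z: "z \<in> K" "z \<noteq> 0 \<and> dist z 0 < 1 / (\<bar>b\<bar> + 1)"
          define t where "t = Re (1 / z)"
          have "norm (complex_of_real t + \<i>) = 1 / norm z"
            using res_inv[OF z(1)] z(2) unfolding t_def[symmetric]
            by (auto simp: res_def norm_divide)
          moreover have "1 / norm z > \<bar>b\<bar> + 1" using z(2) by (simp add: field_simps)
          moreover have "norm (complex_of_real t + \<i>) \<le> \<bar>t\<bar> + 1"
            using norm_triangle_ineq[of "complex_of_real t" \<i>] by simp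
          ultimately have "\<bar>t\<bar> \<ge> b" by linarith
          with b[of t] z show "dist (F z) 0 < d" by (simp add: F_def t_def)
        qed
      qed
      then show ?thesis using True by (simp add: continuous_within F_def)
    qed
    then have "continuous_on K F" by (simp add: continuous_on_eq_continuous_within)
    \<comment> \<open>The approximation error enters twice, at \<open>res t\<close> and at 0 where
      \<open>G 0\<close> is subtracted; hence \<open>e / 2\<close>.\<close>
    then obtain G where G: "G \<in> R" "\<And>z. z \<in> K \<Longrightarrow> \<bar>F z - G z\<bar> < e / 2"
      using function_ring_on.Stone_Weierstrass_basic[OF R, of F "e / 2"] e by auto
    show "\<exists>g\<in>A. \<forall>t. norm (complex_of_real (h t) - g t) < e"
    proof (intro bexI allI)
      show "(\<lambda>t. complex_of_real (G (res t) - G 0)) \<in> A" using G by (simp add: R_def)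
      fix t
      have "F (res t) = h t" "F 0 = 0" using Re_inv[of t] by (simp_all add: F_def) (simp add: res_def)
      then have "\<bar>h t - (G (res t) - G 0)\<bar> < e"
        using G(2)[OF resK[of t]] G(2)[OF zK] by linarith
      then show "norm (complex_of_real (h t) - complex_of_real (G (res t) - G 0)) < e"
        by (simp only: of_real_diff[symmetric] norm_of_real)
    qed
  qed
  show ?thesis
  proof
    fix f assume f: "f \<in> C0"
    have "(\<lambda>t. complex_of_real (Re (f t))) \<in> C0" "(\<lambda>t. complex_of_real (Im (f t))) \<in> C0"
      using f by (simp_all add: C0_Re C0_Im)
    then have "(\<lambda>t. complex_of_real (Re (f t)) + \<i> * complex_of_real (Im (f t))) \<in> A"
      by (intro add cmult real)
    then show "f \<in> A" by (simp add: complex_eq[symmetric])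
  qed
qed

section \<open>Hilbert modules\<close>

context hilbert_module
begin

lemma ip_add_left: "\<langle>x + y, z\<rangle> = \<langle>x, z\<rangle> + \<langle>y, z\<rangle>"
  by (metis ip_add_right ip_star star_add)

lemma ip_scaleC_left: "\<langle>c *\<^sub>C x, y\<rangle> = cnj c *\<^sub>C \<langle>x, y\<rangle>"
  by (metis ip_scaleC_right ip_star star_scaleC)

lemma ip_scaleR_left: "\<langle>r *\<^sub>R x, y\<rangle> = r *\<^sub>R \<langle>x, y\<rangle>"
  using ip_scaleC_left[of "complex_of_real r" x y] by (simp add: scaleC_of_real)

lemma ip_scaleR_right: "\<langle>x, r *\<^sub>R y\<rangle> = r *\<^sub>R \<langle>x, y\<rangle>"
  using ip_scaleC_right[of x "complex_of_real r" y] by (simp add: scaleC_of_real)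

lemma ip_minus_left: "\<langle>- x, y\<rangle> = - \<langle>x, y\<rangle>"
  using ip_scaleR_left[of "-1"] by simp

lemma ip_minus_right: "\<langle>x, - y\<rangle> = - \<langle>x, y\<rangle>"
  using ip_scaleR_right[of _ "-1"] by simp

lemma ip_diff_left: "\<langle>x - y, z\<rangle> = \<langle>x, z\<rangle> - \<langle>y, z\<rangle>"
  using ip_add_left[of x "- y" z] by (simp add: ip_minus_left)

lemma ip_diff_right: "\<langle>z, x - y\<rangle> = \<langle>z, x\<rangle> - \<langle>z, y\<rangle>"
  using ip_add_right[of z x "- y"] by (simp add: ip_minus_right)

lemma ip_zero_left [simp]: "\<langle>0, y\<rangle> = 0" using ip_diff_left[of 0 0 y] by simp
lemma ip_zero_right [simp]: "\<langle>y, 0\<rangle> = 0" using ip_diff_right[of y 0 0] by simp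

lemma norm_ip_self: "norm \<langle>x, x\<rangle> = (norm x)\<^sup>2"
  by (metis norm_eq_ip norm_ge_zero real_sqrt_pow2)

lemma ip_self_eq_0D: "\<langle>x, x\<rangle> = 0 \<Longrightarrow> x = 0"
  using norm_ip_self[of x] by simp

text \<open>Polarization gives a Cauchy-Schwarz inequality up to a constant without any use of the
  order of the C*-algebra.\<close>

lemma norm_ip_le: "norm \<langle>x, y\<rangle> \<le> norm x * norm y * 4"
proof -
  have sym: "norm (\<langle>x, y\<rangle> + \<langle>y, x\<rangle>) \<le> (norm x + norm y)\<^sup>2" for x y
  proof -
    have "2 *\<^sub>R (\<langle>x, y\<rangle> + \<langle>y, x\<rangle>) = \<langle>x + y, x + y\<rangle> - \<langle>x - y, x - y\<rangle>"
      by (simp add: ip_add_left ip_add_right ip_diff_left ip_diff_right scaleR_2)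
    then have "2 * norm (\<langle>x, y\<rangle> + \<langle>y, x\<rangle>) = norm (\<langle>x + y, x + y\<rangle> - \<langle>x - y, x - y\<rangle>)"
      by (metis abs_numeral norm_scaleR)
    also have "\<dots> \<le> (norm (x + y))\<^sup>2 + (norm (x - y))\<^sup>2"
      by (metis norm_triangle_ineq4 norm_ip_self)
    also have "\<dots> \<le> (norm x + norm y)\<^sup>2 + (norm x + norm y)\<^sup>2"
      by (intro add_mono power_mono norm_triangle_ineq norm_triangle_ineq4) auto
    finally show ?thesis by simp
  qed
  \<comment> \<open>The bound \<open>sym\<close> is not homogeneous in each variable, so it is used
    on unit vectors only. Applied to \<open>y\<close> and to \<open>\<i> *\<^sub>C y\<close> it
    controls twice the inner product by 4 + 4.\<close>
  have unit: "norm \<langle>x, y\<rangle> \<le> 4" if "norm x = 1" "norm y = 1" for x y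
  proof -
    have "2 *\<^sub>R \<langle>x, y\<rangle> = (\<langle>x, y\<rangle> + \<langle>y, x\<rangle>) + (- \<i>) *\<^sub>C (\<langle>x, \<i> *\<^sub>C y\<rangle> + \<langle>\<i> *\<^sub>C y, x\<rangle>)"
      by (simp add: ip_scaleC_left ip_scaleC_right scaleC_simps scaleR_2)
    then have "2 * norm \<langle>x, y\<rangle> = norm ((\<langle>x, y\<rangle> + \<langle>y, x\<rangle>) + (- \<i>) *\<^sub>C (\<langle>x, \<i> *\<^sub>C y\<rangle> + \<langle>\<i> *\<^sub>C y, x\<rangle>))"
      by (metis abs_numeral norm_scaleR)
    also have "\<dots> \<le> norm (\<langle>x, y\<rangle> + \<langle>y, x\<rangle>) + norm (\<langle>x, \<i> *\<^sub>C y\<rangle> + \<langle>\<i> *\<^sub>C y, x\<rangle>)"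
      by (rule order_trans[OF norm_triangle_ineq]) (simp add: norm_scaleC)
    also have "\<dots> \<le> (norm x + norm y)\<^sup>2 + (norm x + norm (\<i> *\<^sub>C y))\<^sup>2"
      by (intro add_mono sym)
    also have "\<dots> = 8" by (simp add: that norm_scaleC)
    finally show ?thesis by simp
  qed
  show ?thesis
  proof (cases "x = 0 \<or> y = 0")
    case False
    have "\<langle>x, y\<rangle> = (norm x * norm y) *\<^sub>R \<langle>sgn x, sgn y\<rangle>"
      using False by (simp add: sgn_div_norm ip_scaleR_left ip_scaleR_right field_simps)
    then have "norm \<langle>x, y\<rangle> = norm x * norm y * norm \<langle>sgn x, sgn y\<rangle>"
      by (metis abs_mult abs_norm_cancel norm_scaleR)
    also have "\<dots> \<le> norm x * norm y * 4"
      using False by (intro mult_left_mono unit) (auto simp: norm_sgn)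
    finally show ?thesis .
  qed auto
qed

lemma bounded_bilinear_ip: "bounded_bilinear ip"
  by (rule bounded_bilinear.intro)
    (auto simp: ip_add_left ip_add_right ip_scaleR_left ip_scaleR_right intro: norm_ip_le)

lemmas tendsto_ip = bounded_bilinear.tendsto[OF bounded_bilinear_ip]

text \<open>The inner square of \<open>x \<cdot> b\<close> is
  \<open>star b * (\<langle>x, x\<rangle> * b)\<close>, whose norm is bounded by submultiplicativity
  and the isometry of \<open>star\<close>.\<close>

lemma norm_act_le: "norm (x \<cdot> b) \<le> norm x * norm b"
proof -
  have "\<langle>x \<cdot> b, y\<rangle> = star b * \<langle>x, y\<rangle>" for y
    by (metis ip_act_right ip_star star_mult star_star)
  then have "(norm (x \<cdot> b))\<^sup>2 = norm (star b * (\<langle>x, x\<rangle> * b))"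
    by (simp add: norm_ip_self[symmetric] ip_act_right mult.assoc)
  also have "\<dots> \<le> norm (star b) * (norm \<langle>x, x\<rangle> * norm b)"
    by (meson norm_mult_ineq mult_left_mono norm_ge_zero order_trans)
  also have "\<dots> = (norm x * norm b)\<^sup>2"
    by (simp add: norm_ip_self power_mult_distrib power2_eq_square)
  finally show ?thesis by (rule power2_le_imp_le) simp
qed

lemma act_scaleR_left: "(r *\<^sub>R x) \<cdot> b = r *\<^sub>R (x \<cdot> b)"
  using act_scaleC_left[of "complex_of_real r" x b] by (simp add: scaleC_of_real)

lemma bounded_linear_act: "bounded_linear (\<lambda>x. x \<cdot> b)"
  by (rule bounded_linear_intro[where K = "norm b"])
    (auto simp: act_add_left act_scaleR_left norm_act_le)

lemmas tendsto_act = bounded_linear.tendsto[OF bounded_linear_act]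

lemma submodule_UNIV: "submodule UNIV"
  by (simp add: submodule_def csubspace_def)

lemma submodule_csubspace: "submodule E \<Longrightarrow> csubspace E"
  by (simp add: submodule_def)

lemma submodule_diff: "submodule E \<Longrightarrow> x \<in> E \<Longrightarrow> y \<in> E \<Longrightarrow> x - y \<in> E"
  by (simp add: submodule_csubspace csubspace_diff)

lemma submodule_add: "submodule E \<Longrightarrow> x \<in> E \<Longrightarrow> y \<in> E \<Longrightarrow> x + y \<in> E"
  by (simp add: submodule_def csubspace_def)

lemma submodule_scaleC: "submodule E \<Longrightarrow> x \<in> E \<Longrightarrow> c *\<^sub>C x \<in> E"
  by (simp add: submodule_def csubspace_def)

lemma submodule_act: "submodule E \<Longrightarrow> x \<in> E \<Longrightarrow> x \<cdot> b \<in> E"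
  by (simp add: submodule_def)

lemma ip_eq_on_submodule:
  assumes "submodule E" "y \<in> E" "z \<in> E" "\<And>x. x \<in> E \<Longrightarrow> \<langle>x, y\<rangle> = \<langle>x, z\<rangle>"
  shows "y = z"
proof -
  have "y - z \<in> E" using assms by (intro submodule_diff)
  with assms(4) have "\<langle>y - z, y - z\<rangle> = 0" by (simp add: ip_diff_right)
  then show ?thesis using ip_self_eq_0D by fastforce
qed

lemma adj_eqI:
  assumes "submodule E" "y \<in> E" "z \<in> E" "\<And>x. x \<in> E \<Longrightarrow> \<langle>T x, y\<rangle> = \<langle>x, z\<rangle>"
  shows "adj E T y = z"
proof -
  have "(THE z. z \<in> E \<and> (\<forall>x\<in>E. \<langle>T x, y\<rangle> = \<langle>x, z\<rangle>)) = z"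
  proof (rule the_equality)
    fix w assume "w \<in> E \<and> (\<forall>x\<in>E. \<langle>T x, y\<rangle> = \<langle>x, w\<rangle>)"
    then show "w = z" using assms by (intro ip_eq_on_submodule) auto
  qed (use assms in auto)
  then show ?thesis using assms by (simp add: adj_def)
qed

lemma ip_adj:
  assumes "submodule E" "T \<in> adjointable E" "x \<in> E" "y \<in> E"
  shows "\<langle>T x, y\<rangle> = \<langle>x, adj E T y\<rangle>"
proof -
  obtain S where S: "\<And>y. y \<in> E \<Longrightarrow> S y \<in> E \<and> (\<forall>x\<in>E. \<langle>T x, y\<rangle> = \<langle>x, S y\<rangle>)"
    using assms(2) unfolding adjointable_def by blast
  have "adj E T y = S y" using assms S[of y] by (intro adj_eqI) auto
  then show ?thesis using S assms by simp
qed

end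

text \<open>Leaving \<open>E\<close> arbitrary lets the same estimates serve \<open>\<phi>\<close>
  on the whole module, its restriction to a submodule and every candidate for the functional
  calculus.\<close>

locale C0_representation = hilbert_module act ip
  for act :: "'h::complex_banach \<Rightarrow> 'b::cstar_algebra \<Rightarrow> 'h"  (infixl "\<cdot>" 75)
    and ip :: "'h \<Rightarrow> 'h \<Rightarrow> 'b"  ("\<langle>_, _\<rangle>") +
  fixes E :: "'h set" and \<pi> :: "(real \<Rightarrow> complex) \<Rightarrow> 'h \<Rightarrow> 'h"
  assumes submodule_E: "submodule E" and C0_star_hom: "C0_star_hom E \<pi>"
begin

section \<open>Norm bounds, continuity and uniqueness of representations of
  \<open>C0\<close>\<close>

lemma adjointable_\<pi>: "f \<in> C0 \<Longrightarrow> \<pi> f \<in> adjointable E"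
  using C0_star_hom by (simp add: C0_star_hom_def)

lemma \<pi>_closed: "f \<in> C0 \<Longrightarrow> x \<in> E \<Longrightarrow> \<pi> f x \<in> E"
  using adjointable_\<pi> by (auto simp: adjointable_def)

lemma \<pi>_outside: "f \<in> C0 \<Longrightarrow> x \<notin> E \<Longrightarrow> \<pi> f x = 0"
  using adjointable_\<pi> by (auto simp: adjointable_def)

lemma \<pi>_add_right: "f \<in> C0 \<Longrightarrow> x \<in> E \<Longrightarrow> y \<in> E \<Longrightarrow> \<pi> f (x + y) = \<pi> f x + \<pi> f y"
  using adjointable_\<pi> by (auto simp: adjointable_def)

lemma \<pi>_scaleC_right: "f \<in> C0 \<Longrightarrow> x \<in> E \<Longrightarrow> \<pi> f (c *\<^sub>C x) = c *\<^sub>C \<pi> f x"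
  using adjointable_\<pi> by (auto simp: adjointable_def)

lemma \<pi>_act: "f \<in> C0 \<Longrightarrow> x \<in> E \<Longrightarrow> \<pi> f (x \<cdot> b) = \<pi> f x \<cdot> b"
  using adjointable_\<pi> by (auto simp: adjointable_def)

lemma \<pi>_diff_right: "f \<in> C0 \<Longrightarrow> x \<in> E \<Longrightarrow> y \<in> E \<Longrightarrow> \<pi> f (x - y) = \<pi> f x - \<pi> f y"
  using \<pi>_add_right[of f x "- y"] \<pi>_scaleC_right[of f y "- 1"] csubspace_minus[of E y] submodule_E
  by (simp add: scaleC_minus_left submodule_def)

lemma \<pi>_add: "f \<in> C0 \<Longrightarrow> g \<in> C0 \<Longrightarrow> \<pi> (\<lambda>t. f t + g t) x = \<pi> f x + \<pi> g x"
  using C0_star_hom by (simp add: C0_star_hom_def)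

lemma \<pi>_cmult: "f \<in> C0 \<Longrightarrow> \<pi> (\<lambda>t. c * f t) x = c *\<^sub>C \<pi> f x"
  using C0_star_hom by (simp add: C0_star_hom_def)

lemma \<pi>_mult: "f \<in> C0 \<Longrightarrow> g \<in> C0 \<Longrightarrow> \<pi> (\<lambda>t. f t * g t) x = \<pi> f (\<pi> g x)"
  using C0_star_hom by (simp add: C0_star_hom_def)

lemma \<pi>_diff: "f \<in> C0 \<Longrightarrow> g \<in> C0 \<Longrightarrow> \<pi> (\<lambda>t. f t - g t) x = \<pi> f x - \<pi> g x"
  using \<pi>_add[of f "\<lambda>t. (- 1) * g t" x] \<pi>_cmult[of g "- 1" x] C0_cmult[of g "- 1"]
  by (simp add: scaleC_minus_left)

lemma \<pi>_zero: "\<pi> (\<lambda>t. 0) x = 0"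
  using \<pi>_cmult[OF res_C0, of 0 x] by simp

lemma \<pi>_ip:
  assumes "f \<in> C0" "x \<in> E" "y \<in> E"
  shows "\<langle>\<pi> f x, y\<rangle> = \<langle>x, \<pi> (\<lambda>t. cnj (f t)) y\<rangle>"
proof -
  have "\<pi> (\<lambda>t. cnj (f t)) = adj E (\<pi> f)"
    using C0_star_hom assms(1) by (simp add: C0_star_hom_def)
  then show ?thesis using ip_adj[OF submodule_E adjointable_\<pi>] assms by simp
qed

text \<open>The function \<open>\<kappa> + g\<close> is unimodular, so
  \<open>\<kappa> + \<pi> g\<close> should be an isometry. Once the constant
  \<open>\<kappa> * cnj \<kappa> = 1\<close> is cancelled, unimodularity is a relation inside
  \<open>C0\<close>, and \<open>\<pi>\<close> respects it.\<close>

lemma norm_unitary: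
  assumes g: "g \<in> C0" and \<kappa>: "norm \<kappa> = 1" and u: "\<And>t. norm (\<kappa> + g t) = 1" and x: "x \<in> E"
  shows "norm (\<kappa> *\<^sub>C x + \<pi> g x) = norm x"
proof -
  let ?g = "\<lambda>t. cnj (g t)"
  have g': "?g \<in> C0" using g by (rule C0_cnj)
  have "(\<lambda>t. (cnj \<kappa> * g t + \<kappa> * ?g t) + ?g t * g t) = (\<lambda>t. 0)"
  proof
    fix t
    have "(\<kappa> + g t) * cnj (\<kappa> + g t) = 1" "\<kappa> * cnj \<kappa> = 1"
      using u[of t] \<kappa> by (simp_all only: complex_norm_square[symmetric]) simp_all
    then show "(cnj \<kappa> * g t + \<kappa> * ?g t) + ?g t * g t = 0" by (simp add: algebra_simps)
  qed
  then have "\<pi> (\<lambda>t. (cnj \<kappa> * g t + \<kappa> * ?g t) + ?g t * g t) x = 0" by (simp add: \<pi>_zero)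
  then have "(cnj \<kappa> *\<^sub>C \<pi> g x + \<kappa> *\<^sub>C \<pi> ?g x) + \<pi> ?g (\<pi> g x) = 0"
    using g g' by (simp only: \<pi>_add \<pi>_cmult \<pi>_mult C0_add C0_cmult C0_mult)
  then have 0: "\<langle>x, (cnj \<kappa> *\<^sub>C \<pi> g x + \<kappa> *\<^sub>C \<pi> ?g x) + \<pi> ?g (\<pi> g x)\<rangle> = 0" by simp
  have "\<kappa> * cnj \<kappa> = 1" using \<kappa> by (simp only: complex_norm_square[symmetric]) simp
  then have "\<langle>\<kappa> *\<^sub>C x + \<pi> g x, \<kappa> *\<^sub>C x + \<pi> g x\<rangle>
    = \<langle>x, x\<rangle> + \<langle>x, (cnj \<kappa> *\<^sub>C \<pi> g x + \<kappa> *\<^sub>C \<pi> ?g x) + \<pi> ?g (\<pi> g x)\<rangle>"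
    using g x by (simp add: ip_add_left ip_add_right ip_scaleC_left ip_scaleC_right \<pi>_ip \<pi>_closed
        scaleC_scaleC scaleC_add_right algebra_simps)
  with 0 show ?thesis by (simp add: norm_eq_ip)
qed

text \<open>A real function \<open>h\<close> with \<open>\<bar>h\<bar> \<le> 1\<close> is the real part of the unimodular function
  \<open>h + \<i> sqrt (1 - h\<^sup>2)\<close>, which differs from the constant \<open>\<i>\<close> by an element of \<open>C0\<close>.\<close>

lemma norm_\<pi>_real_le:
  assumes h: "(\<lambda>t. complex_of_real (h t)) \<in> C0" and c: "c > 0" "\<And>t. \<bar>h t\<bar> \<le> c" and x: "x \<in> E"
  shows "norm (\<pi> (\<lambda>t. complex_of_real (h t)) x) \<le> c * norm x"
proof -
  define g where "g t = Complex (h t / c) (sqrt (1 - (h t / c)\<^sup>2) - 1)" for t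
  have "(\<lambda>t. complex_of_real (Re (complex_of_real (h t)) / c)
      + \<i> * complex_of_real (sqrt (1 - (Re (complex_of_real (h t)) / c)\<^sup>2) - 1)) \<in> C0"
    using c by (intro C0_compose[OF h]) (auto intro!: continuous_intros)
  then have g: "g \<in> C0" unfolding g_def by (simp add: Complex_eq)
  then have g': "(\<lambda>t. cnj (g t)) \<in> C0" by (rule C0_cnj)
  have u: "norm (\<i> + g t) = 1" for t
  proof -
    have "(h t / c)\<^sup>2 \<le> 1"
      using c(1) c(2)[of t] by (simp add: abs_square_le_1)
    then show ?thesis by (simp add: cmod_def g_def)
  qed
  have u': "norm (- \<i> + cnj (g t)) = 1" for t
    using u[of t] complex_mod_cnj[of "\<i> + g t"] by simp
  \<comment> \<open>The two unitaries have constant parts \<open>\<i>\<close> and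
    \<open>- \<i>\<close>, which cancel in the sum; thus \<open>h\<close> is \<open>c\<close> times
    their mean.\<close>
  have "(\<lambda>t. complex_of_real (h t)) = (\<lambda>t. complex_of_real (c / 2) * (g t + cnj (g t)))"
    using c(1) by (auto simp: complex_eq_iff g_def)
  then have "\<pi> (\<lambda>t. complex_of_real (h t)) x = (c / 2) *\<^sub>R (\<pi> g x + \<pi> (\<lambda>t. cnj (g t)) x)"
    using g g' by (simp only: \<pi>_cmult \<pi>_add C0_add scaleC_of_real)
  also have "\<dots> = (c / 2) *\<^sub>R ((\<i> *\<^sub>C x + \<pi> g x) + ((- \<i>) *\<^sub>C x + \<pi> (\<lambda>t. cnj (g t)) x))"
    by (simp add: scaleC_minus_left)
  finally have "norm (\<pi> (\<lambda>t. complex_of_real (h t)) x)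
    = c / 2 * norm ((\<i> *\<^sub>C x + \<pi> g x) + ((- \<i>) *\<^sub>C x + \<pi> (\<lambda>t. cnj (g t)) x))"
    using c(1) by simp
  also have "\<dots> \<le> c / 2 * (norm (\<i> *\<^sub>C x + \<pi> g x) + norm ((- \<i>) *\<^sub>C x + \<pi> (\<lambda>t. cnj (g t)) x))"
    using c(1) by (intro mult_left_mono norm_triangle_ineq) auto
  also have "\<dots> = c / 2 * (norm x + norm x)"
    using norm_unitary[OF g _ u x] norm_unitary[OF g' _ u' x] by simp
  finally show ?thesis by simp
qed

text \<open>The bound for real functions is applied to the real and the imaginary part, whence the
  factor 2.\<close>

lemma norm_\<pi>_le:
  assumes f: "f \<in> C0" and c: "c > 0" "\<And>t. norm (f t) \<le> c" and x: "x \<in> E"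
  shows "norm (\<pi> f x) \<le> 2 * c * norm x"
proof -
  have re: "(\<lambda>t. complex_of_real (Re (f t))) \<in> C0" and im: "(\<lambda>t. complex_of_real (Im (f t))) \<in> C0"
    using f by (simp_all add: C0_Re C0_Im)
  have "f = (\<lambda>t. complex_of_real (Re (f t)) + \<i> * complex_of_real (Im (f t)))"
    by (simp add: complex_eq[symmetric])
  then have "\<pi> f x = \<pi> (\<lambda>t. complex_of_real (Re (f t)) + \<i> * complex_of_real (Im (f t))) x"
    by (rule arg_cong)
  also have "\<dots> = \<pi> (\<lambda>t. complex_of_real (Re (f t))) x + \<i> *\<^sub>C \<pi> (\<lambda>t. complex_of_real (Im (f t))) x"
    using re im by (simp only: \<pi>_cmult \<pi>_add C0_cmult)
  finally have "\<pi> f x = \<dots>" .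
  also have "norm \<dots> \<le> norm (\<pi> (\<lambda>t. complex_of_real (Re (f t))) x) + norm (\<pi> (\<lambda>t. complex_of_real (Im (f t))) x)"
    by (rule order_trans[OF norm_triangle_ineq]) (simp add: norm_scaleC)
  also have "\<dots> \<le> c * norm x + c * norm x"
    by (intro add_mono norm_\<pi>_real_le re im c x order_trans[OF abs_Re_le_cmod]
        order_trans[OF abs_Im_le_cmod])
  finally show ?thesis by simp
qed

lemma tendsto_\<pi>:
  assumes lim: "uniform_limit UNIV F f \<F>" and F: "\<forall>\<^sub>F n in \<F>. F n \<in> C0" and f: "f \<in> C0" and x: "x \<in> E"
  shows "((\<lambda>n. \<pi> (F n) x) \<longlongrightarrow> \<pi> f x) \<F>"
proof (rule tendstoI)
  fix e :: real assume e: "e > 0"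
  \<comment> \<open>The summand 1 keeps \<open>d\<close> positive when \<open>x = 0\<close>.\<close>
  define d where "d = e / (2 * (norm x + 1))"
  have d: "d > 0" "2 * d * norm x < e"
    using e by (auto simp: d_def field_simps add_pos_nonneg add_nonneg_pos)
  have "\<forall>\<^sub>F n in \<F>. \<forall>t\<in>UNIV. dist (F n t) (f t) < d"
    using uniform_limitD[OF lim d(1)] .
  then show "\<forall>\<^sub>F n in \<F>. dist (\<pi> (F n) x) (\<pi> f x) < e"
    using F
  proof eventually_elim
    case (elim n)
    then have "norm (\<pi> (\<lambda>t. F n t - f t) x) \<le> 2 * d * norm x"
      using f x d by (intro norm_\<pi>_le C0_diff) (auto simp: dist_norm intro: less_imp_le)
    then show ?case using d elim f by (simp add: \<pi>_diff dist_norm)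
  qed
qed

end

text \<open>By the norm bounds, the functions on which both agree form a subalgebra of
  \<open>C0\<close> closed under uniform limits, and \<open>res\<close> with its conjugate generates
  \<open>C0\<close>. Outside \<open>E\<close> both values are 0.\<close>

lemma (in hilbert_module) C0_representation_unique:
  assumes \<pi>: "C0_representation act ip E \<pi>" and \<rho>: "C0_representation act ip E \<rho>"
    and "\<pi> res = \<rho> res" "\<pi> (\<lambda>t. cnj (res t)) = \<rho> (\<lambda>t. cnj (res t))" and "f \<in> C0"
  shows "\<pi> f = \<rho> f"
proof -
  interpret \<pi>: C0_representation act ip E \<pi> by fact
  interpret \<rho>: C0_representation act ip E \<rho> by fact
  define A where "A = {f \<in> C0. \<forall>x. \<pi> f x = \<rho> f x}"
  have "C0 \<subseteq> A"
  proof (rule C0_generated_by_res)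
    fix f assume f: "f \<in> C0" and appr: "\<And>e. e > 0 \<Longrightarrow> \<exists>g\<in>A. \<forall>t. norm (f t - g t) < e"
    have "\<pi> f x = \<rho> f x" for x
    proof (cases "x \<in> E")
      case x: True
      have "norm (\<pi> f x - \<rho> f x) \<le> 0 + e" if "e > 0" for e
      proof -
        define d where "d = e / (4 * (norm x + 1))"
        have d: "d > 0" "2 * d * norm x + 2 * d * norm x \<le> e"
          using \<open>e > 0\<close> by (auto simp: d_def field_simps add_pos_nonneg add_nonneg_pos)
        obtain g where g: "g \<in> A" "\<And>t. norm (f t - g t) < d" using appr[OF d(1)] by auto
        have "norm (\<pi> (\<lambda>t. f t - g t) x) \<le> 2 * d * norm x" "norm (\<rho> (\<lambda>t. f t - g t) x) \<le> 2 * d * norm x"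
          using f g d x by (auto intro!: \<pi>.norm_\<pi>_le \<rho>.norm_\<pi>_le C0_diff simp: A_def intro: less_imp_le)
        moreover have "\<pi> f x - \<rho> f x = \<pi> (\<lambda>t. f t - g t) x - \<rho> (\<lambda>t. f t - g t) x"
          using f g by (simp add: A_def \<pi>.\<pi>_diff \<rho>.\<pi>_diff)
        ultimately show ?thesis
          using d norm_triangle_ineq4[of "\<pi> (\<lambda>t. f t - g t) x" "\<rho> (\<lambda>t. f t - g t) x"] by simp
      qed
      then have "norm (\<pi> f x - \<rho> f x) \<le> 0" by (rule field_le_epsilon)
      then show ?thesis by simp
    qed (simp add: f \<pi>.\<pi>_outside \<rho>.\<pi>_outside)
    with f show "f \<in> A" by (simp add: A_def)
  qed (use assms(3,4) in \<open>auto simp: A_def \<pi>.\<pi>_add \<rho>.\<pi>_add \<pi>.\<pi>_mult \<rho>.\<pi>_mult \<pi>.\<pi>_cmult \<rho>.\<pi>_cmult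
      intro: C0_add C0_mult C0_cmult C0_cnj res_C0\<close>)
  with assms(5) show ?thesis by (auto simp: A_def)
qed

text \<open>The cross terms of \<open>\<langle>y + z, y + z\<rangle>\<close> are odd, so
  \<open>\<beta>\<close> maps this element to \<open>\<langle>y - z, y - z\<rangle>\<close>. The
  bound for \<open>\<beta>\<close> thus controls \<open>y - z\<close>, and \<open>y\<close> is the
  mean of \<open>y + z\<close> and \<open>y - z\<close>.\<close>

lemma (in graded_hilbert_module) norm_even_part_le:
  assumes y: "y \<in> H 0" and z: "z \<in> H 1"
  shows "norm y \<le> 2 * norm (y + z)"
proof -
  have "\<beta> \<langle>y, y\<rangle> = \<langle>y, y\<rangle>" "\<beta> \<langle>z, z\<rangle> = \<langle>z, z\<rangle>" "\<beta> \<langle>y, z\<rangle> = - \<langle>y, z\<rangle>" "\<beta> \<langle>z, y\<rangle> = - \<langle>z, y\<rangle>"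
    using H_ip[OF y y] H_ip[OF z z] H_ip[OF y z] H_ip[OF z y] by (auto simp: cstar_degree_def)
  then have "\<beta> \<langle>y + z, y + z\<rangle> = \<langle>y - z, y - z\<rangle>"
    by (simp add: ip_add_left ip_add_right ip_diff_left ip_diff_right \<beta>_add)
  then have "norm \<langle>y - z, y - z\<rangle> \<le> 2 * norm \<langle>y + z, y + z\<rangle>"
    using norm_\<beta>_self_adjoint_le[of "\<langle>y + z, y + z\<rangle>"] by (simp add: ip_star)
  \<comment> \<open>The factor 2 is weakened to 4, a perfect square.\<close>
  then have "(norm (y - z))\<^sup>2 \<le> (2 * norm (y + z))\<^sup>2"
    by (simp add: norm_ip_self power_mult_distrib) (smt (verit) zero_le_power2)
  then have "norm (y - z) \<le> 2 * norm (y + z)"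
    by (rule power2_le_imp_le) simp
  moreover have "y = (1 / 2) *\<^sub>R ((y + z) + (y - z))"
    by (simp add: scaleR_2[symmetric])
  then have "norm y = 1 / 2 * norm ((y + z) + (y - z))"
    by (metis norm_scaleR abs_of_nonneg zero_le_divide_1_iff zero_le_numeral)
  ultimately show ?thesis using norm_triangle_ineq[of "y + z" "y - z"] norm_ge_zero[of "y + z"] by linarith
qed

section \<open>The self-adjoint generator\<close>

locale C0_action = C0_representation act ip UNIV \<phi>
  for act :: "'h::complex_banach \<Rightarrow> 'b::cstar_algebra \<Rightarrow> 'h"  (infixl "\<cdot>" 75)
    and ip :: "'h \<Rightarrow> 'h \<Rightarrow> 'b"  ("\<langle>_, _\<rangle>")
    and \<phi>
begin

lemma bounded_linear_\<phi>: "f \<in> C0 \<Longrightarrow> bounded_linear (\<phi> f)"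
proof -
  assume f: "f \<in> C0"
  obtain K where "\<And>t. norm (f t) \<le> K" using C0_bounded[OF f] by auto
  then have K: "\<And>t. norm (f t) \<le> max K 1" by (simp add: le_max_iff_disj)
  show ?thesis
  proof (rule bounded_linear_intro)
    show "\<phi> f (r *\<^sub>R x) = r *\<^sub>R \<phi> f x" for r x
      using \<pi>_scaleC_right[OF f, of x "complex_of_real r"] by (simp add: scaleC_of_real)
    show "norm (\<phi> f x) \<le> norm x * (2 * max K 1)" for x
      using norm_\<pi>_le[OF f _ K, of x] by (simp add: mult_ac)
  qed (simp add: \<pi>_add_right f)
qed

lemmas tendsto_\<phi> = bounded_linear.tendsto[OF bounded_linear_\<phi>]

section \<open>The essential submodule and the restricted representation\<close>

lemma norm_\<phi>_plateau_le: "norm (\<phi> (plateau n) x) \<le> 2 * norm x"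
  using norm_\<pi>_le[OF plateau_C0, of 1 n x] norm_plateau_le by simp

text \<open>This is the closed span of the ranges of all \<open>\<phi> f\<close>; defining it by
  convergence lets one sequence decide membership.\<close>

definition essential :: "'h set" where
  "essential = {x. (\<lambda>n. \<phi> (plateau n) x) \<longlonglongrightarrow> x}"

lemma essential_tendsto: "x \<in> essential \<Longrightarrow> (\<lambda>n. \<phi> (plateau n) x) \<longlonglongrightarrow> x"
  by (simp add: essential_def)

text \<open>The products of \<open>plateau n\<close> and \<open>f\<close> tend uniformly to
  \<open>f\<close>, and \<open>\<phi>\<close> turns this into convergence at
  \<open>x\<close>.\<close>

lemma \<phi>_essential: "f \<in> C0 \<Longrightarrow> \<phi> f x \<in> essential"
  using tendsto_\<pi>[OF uniform_limit_plateau, of f x]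
  by (simp add: essential_def \<pi>_mult plateau_C0 C0_mult)

lemma submodule_essential: "submodule essential"
  unfolding submodule_def csubspace_def essential_def
  by (auto simp: plateau_C0 \<pi>_add_right \<pi>_scaleC_right \<pi>_act bounded_linear_\<phi> bounded_linear.linear[THEN linear_0]
      intro: tendsto_add tendsto_scaleC tendsto_act)

text \<open>A three-term estimate: the operators \<open>\<phi> (plateau n)\<close> are bounded by 2
  uniformly in \<open>n\<close>, so accuracy \<open>e / 4\<close> contributes \<open>e / 2\<close>,
  \<open>e / 4\<close> and \<open>e / 4\<close>.\<close>

lemma closed_essential: "closed essential"
proof -
  have "x \<in> essential" if x: "x \<in> closure essential" for x
    unfolding essential_def mem_Collect_eq
  proof (rule tendstoI)
    fix e :: real assume e: "e > 0"
    obtain y where y: "y \<in> essential" "norm (y - x) < e / 4"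
      using x e unfolding closure_approachable dist_norm by (metis zero_less_divide_iff zero_less_numeral)
    have "\<forall>\<^sub>F n in sequentially. dist (\<phi> (plateau n) y) y < e / 4"
      using essential_tendsto[OF y(1)] e by (auto dest: tendstoD[of _ _ _ "e / 4"])
    then show "\<forall>\<^sub>F n in sequentially. dist (\<phi> (plateau n) x) x < e"
    proof eventually_elim
      case (elim n)
      have "\<phi> (plateau n) x - x = \<phi> (plateau n) (x - y) + (\<phi> (plateau n) y - y) + (y - x)"
        by (simp add: \<pi>_diff_right plateau_C0)
      then have "norm (\<phi> (plateau n) x - x)
        \<le> norm (\<phi> (plateau n) (x - y)) + norm (\<phi> (plateau n) y - y) + norm (y - x)"
        by (metis norm_triangle_ineq norm_triangle_mono order_refl)
      then show ?case
        using norm_\<phi>_plateau_le[of n "x - y"] y(2) elim by (simp add: dist_norm norm_minus_commute)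
    qed
  qed
  then show ?thesis by (metis closure_subset closure_subset_eq subsetI)
qed

text \<open>The value 0 outside follows the convention for operators on a submodule, which equality
  with the functional calculus requires.\<close>

definition restriction :: "(real \<Rightarrow> complex) \<Rightarrow> 'h \<Rightarrow> 'h" where
  "restriction f x = (if x \<in> essential then \<phi> f x else 0)"

text \<open>The adjoint is given by \<open>\<phi>\<close> at the conjugate function, whose values
  lie in \<open>essential\<close>; no projection onto \<open>essential\<close> enters.\<close>

lemma restriction_adjointable:
  assumes f: "f \<in> C0" shows "restriction f \<in> adjointable essential"
proof -
  have bound: "\<exists>K. \<forall>x\<in>essential. norm (restriction f x) \<le> K * norm x"
    using bounded_linear.bounded[OF bounded_linear_\<phi>[OF f]] by (auto simp: restriction_def mult.commute)
  have adj: "\<exists>S. \<forall>y\<in>essential. S y \<in> essential \<and> (\<forall>x\<in>essential. \<langle>restriction f x, y\<rangle> = \<langle>x, S y\<rangle>)"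
    by (rule exI[of _ "\<phi> (\<lambda>t. cnj (f t))"]) (simp add: restriction_def \<pi>_ip f \<phi>_essential C0_cnj)
  show ?thesis
    unfolding adjointable_def using bound adj f
    by (simp add: restriction_def \<phi>_essential submodule_add submodule_scaleC submodule_act
        submodule_essential \<pi>_add_right \<pi>_scaleC_right \<pi>_act)
qed

lemma C0_star_hom_restriction: "C0_star_hom essential restriction"
proof -
  have "restriction (\<lambda>t. cnj (f t)) = adj essential (restriction f)" if "f \<in> C0" for f
  proof
    fix y
    show "restriction (\<lambda>t. cnj (f t)) y = adj essential (restriction f) y"
    proof (cases "y \<in> essential")
      case True
      then show ?thesis
        using that by (intro adj_eqI[symmetric] submodule_essential)
          (simp_all add: restriction_def \<phi>_essential C0_cnj \<pi>_ip)
    qed (simp add: restriction_def adj_def)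
  qed
  moreover have "\<phi> f 0 = 0" if "f \<in> C0" for f
    using that bounded_linear_\<phi> bounded_linear.linear linear_0 by blast
  ultimately show ?thesis
    by (auto simp: C0_star_hom_def restriction_adjointable restriction_def fun_eq_iff \<pi>_add \<pi>_cmult
        \<pi>_mult \<phi>_essential)
qed

lemma C0_representation_restriction: "C0_representation act ip essential restriction"
  by unfold_locales (rule submodule_essential C0_star_hom_restriction)+

text \<open>The resolvent identity carried to operators, in both orders of the factors, for passing
  between the two resolvents.\<close>

lemma \<phi>_cnj_res_res: "(2 * \<i>) *\<^sub>C \<phi> (\<lambda>t. cnj (res t)) (\<phi> res x) = \<phi> (\<lambda>t. cnj (res t)) x - \<phi> res x"
  "(2 * \<i>) *\<^sub>C \<phi> res (\<phi> (\<lambda>t. cnj (res t)) x) = \<phi> (\<lambda>t. cnj (res t)) x - \<phi> res x"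
proof -
  have eq: "(\<lambda>t. 2 * \<i> * (cnj (res t) * res t)) = (\<lambda>t. cnj (res t) - res t)"
    "(\<lambda>t. 2 * \<i> * (res t * cnj (res t))) = (\<lambda>t. cnj (res t) - res t)"
    using cnj_res_mult_res by (auto simp: mult.commute)
  show "(2 * \<i>) *\<^sub>C \<phi> (\<lambda>t. cnj (res t)) (\<phi> res x) = \<phi> (\<lambda>t. cnj (res t)) x - \<phi> res x"
    using arg_cong[OF eq(1), of "\<lambda>f. \<phi> f x"]
    by (simp only: \<pi>_cmult \<pi>_mult \<pi>_diff res_C0 cnj_res_C0 C0_mult)
  show "(2 * \<i>) *\<^sub>C \<phi> res (\<phi> (\<lambda>t. cnj (res t)) x) = \<phi> (\<lambda>t. cnj (res t)) x - \<phi> res x"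
    using arg_cong[OF eq(2), of "\<lambda>f. \<phi> f x"]
    by (simp only: \<pi>_cmult \<pi>_mult \<pi>_diff res_C0 cnj_res_C0 C0_mult)
qed

text \<open>Each \<open>plateau n\<close> is \<open>(t + \<i>) * plateau n\<close> times
  \<open>res\<close>, with the first factor in \<open>C0\<close>. So the kernel of
  \<open>\<phi> res\<close> is killed by every \<open>\<phi> (plateau n)\<close>, and these converge
  to the identity on \<open>essential\<close>.\<close>

lemma \<phi>_res_inj:
  assumes x: "x \<in> essential" and 0: "\<phi> res x = 0" shows "x = 0"
proof -
  have "\<phi> (plateau n) x = 0" for n
  proof -
    have "plateau n = (\<lambda>t. (complex_of_real t * plateau n t + \<i> * plateau n t) * res t)"
    proof
      fix t
      show "plateau n t = (complex_of_real t * plateau n t + \<i> * plateau n t) * res t"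
        using mult_res[of t] by algebra
    qed
    then have "\<phi> (plateau n) x = \<phi> (\<lambda>t. (complex_of_real t * plateau n t + \<i> * plateau n t) * res t) x"
      by (rule arg_cong)
    also have "\<dots> = \<phi> (\<lambda>t. complex_of_real t * plateau n t + \<i> * plateau n t) (\<phi> res x)"
      by (intro \<pi>_mult C0_add C0_cmult plateau_mult_C0 plateau_C0 res_C0)
    finally show ?thesis
      by (simp add: 0 bounded_linear_\<phi> C0_add C0_cmult plateau_mult_C0 plateau_C0
          bounded_linear.linear[THEN linear_0])
  qed
  then show ?thesis using essential_tendsto[OF x] by (simp add: LIMSEQ_const_iff)
qed

section \<open>The generator and its resolvent equations\<close>

definition generator :: "'h \<rightharpoonup> 'h" where
  "generator y = (if y \<in> essential \<and> (\<exists>z\<in>essential. y = \<phi> res (z + \<i> *\<^sub>C y))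
    then Some (THE z. z \<in> essential \<and> y = \<phi> res (z + \<i> *\<^sub>C y)) else None)"

text \<open>Injectivity of \<open>\<phi> res\<close> on \<open>essential\<close> makes
  \<open>z\<close> unique, so the definite description can be eliminated.\<close>

lemma generator_iff:
  "generator y = Some z \<longleftrightarrow> y \<in> essential \<and> z \<in> essential \<and> y = \<phi> res (z + \<i> *\<^sub>C y)"
proof -
  have uniq: "z = z'" if z: "z \<in> essential" "z' \<in> essential"
    and eq: "\<phi> res (z + \<i> *\<^sub>C y) = \<phi> res (z' + \<i> *\<^sub>C y)" for z z'
  proof -
    have "\<phi> res (z - z') = 0"
      using \<pi>_diff_right[OF res_C0, of "z + \<i> *\<^sub>C y" "z' + \<i> *\<^sub>C y"] unfolding eq by simp
    then have "z - z' = 0"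
      by (rule \<phi>_res_inj[OF submodule_diff[OF submodule_essential z]])
    then show ?thesis by simp
  qed
  have the: "(THE z. z \<in> essential \<and> y = \<phi> res (z + \<i> *\<^sub>C y)) = z"
    if z: "z \<in> essential" and y: "y = \<phi> res (z + \<i> *\<^sub>C y)" for z
  proof (rule the_equality)
    fix w assume w: "w \<in> essential \<and> y = \<phi> res (w + \<i> *\<^sub>C y)"
    show "w = z" by (rule uniq[OF conjunct1[OF w] z trans[OF conjunct2[OF w, symmetric] y]])
  qed (use z y in blast)
  show ?thesis
  proof
    assume *: "generator y = Some z"
    then obtain w where w: "y \<in> essential" "w \<in> essential" "y = \<phi> res (w + \<i> *\<^sub>C y)"
      by (auto simp: generator_def split: if_splits)
    then have "generator y = Some w" using the[OF w(2,3)] by (auto simp: generator_def)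
    with * w show "y \<in> essential \<and> z \<in> essential \<and> y = \<phi> res (z + \<i> *\<^sub>C y)" by simp
  next
    assume "y \<in> essential \<and> z \<in> essential \<and> y = \<phi> res (z + \<i> *\<^sub>C y)"
    then show "generator y = Some z" using the[of z] by (auto simp: generator_def)
  qed
qed

text \<open>The resolvent identity trades \<open>\<phi> res\<close> for its adjoint. Having both
  descriptions of the same operator is the source of its self-adjointness.\<close>

lemma generator_iff_cnj:
  "generator y = Some z \<longleftrightarrow>
    y \<in> essential \<and> z \<in> essential \<and> y = \<phi> (\<lambda>t. cnj (res t)) (z - \<i> *\<^sub>C y)"
proof -
  have "y = \<phi> res (z + \<i> *\<^sub>C y) \<longleftrightarrow> y = \<phi> (\<lambda>t. cnj (res t)) (z - \<i> *\<^sub>C y)" (is "?l \<longleftrightarrow> ?r")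
  proof
    assume l: ?l
    \<comment> \<open>In operator terms \<open>w\<close> is \<open>(D + \<i>) y\<close>, and
      \<open>(D - \<i>) y\<close> is \<open>w\<close> minus \<open>2 \<i> y\<close>.\<close>
    define w where "w = z + \<i> *\<^sub>C y"
    have y: "y = \<phi> res w" using l by (simp add: w_def)
    have "z - \<i> *\<^sub>C y = w - (2 * \<i>) *\<^sub>C y"
      by (simp add: w_def scaleC_2i)
    then show ?r
      using \<phi>_cnj_res_res(1)[of w] y
      by (simp add: \<pi>_diff_right \<pi>_scaleC_right cnj_res_C0)
  next
    assume r: ?r
    define w where "w = z - \<i> *\<^sub>C y"
    have y: "y = \<phi> (\<lambda>t. cnj (res t)) w" using r by (simp add: w_def)
    have "z + \<i> *\<^sub>C y = w + (2 * \<i>) *\<^sub>C y"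
      by (simp add: w_def scaleC_2i)
    then show ?l
      using \<phi>_cnj_res_res(2)[of w] y
      by (simp add: \<pi>_add_right \<pi>_scaleC_right res_C0)
  qed
  then show ?thesis by (simp add: generator_iff)
qed

text \<open>Factor \<open>f\<close> as \<open>res\<close> times \<open>(t + \<i>) f\<close>; both
  assumptions together put the second factor in \<open>C0\<close>.\<close>

lemma generator_\<phi>:
  assumes f: "f \<in> C0" "(\<lambda>t. complex_of_real t * f t) \<in> C0"
  shows "generator (\<phi> f w) = Some (\<phi> (\<lambda>t. complex_of_real t * f t) w)"
proof -
  have "(\<lambda>t. res t * (complex_of_real t * f t + \<i> * f t)) = f"
  proof
    fix t show "res t * (complex_of_real t * f t + \<i> * f t) = f t"
      using mult_res[of t] by algebra
  qed
  then have "\<phi> f w = \<phi> (\<lambda>t. res t * (complex_of_real t * f t + \<i> * f t)) w" by simp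
  also have "\<dots> = \<phi> res (\<phi> (\<lambda>t. complex_of_real t * f t) w + \<i> *\<^sub>C \<phi> f w)"
    using f by (simp only: \<pi>_mult \<pi>_add \<pi>_cmult C0_add C0_cmult res_C0)
  finally show ?thesis using f by (simp add: generator_iff \<phi>_essential)
qed

text \<open>This recovers \<open>z\<close> as the limit of bounded operators applied to
  \<open>y\<close>, each coming from an odd function; the degree of the generator is read off from
  it.\<close>

lemma \<phi>_plateau_generator:
  assumes "generator y = Some z"
  shows "\<phi> (\<lambda>t. complex_of_real t * plateau n t) y = \<phi> (plateau n) z"
proof -
  define w where "w = z + \<i> *\<^sub>C y"
  have y: "y = \<phi> res w" using assms by (simp add: generator_iff w_def)
  have z: "z = w - \<i> *\<^sub>C y" by (simp add: w_def)
  have "(\<lambda>t. (complex_of_real t * plateau n t) * res t) = (\<lambda>t. plateau n t - \<i> * (plateau n t * res t))"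
  proof
    fix t show "(complex_of_real t * plateau n t) * res t = plateau n t - \<i> * (plateau n t * res t)"
      using mult_res[of t] by algebra
  qed
  from arg_cong[OF this, of "\<lambda>f. \<phi> f w"]
  have "\<phi> (\<lambda>t. complex_of_real t * plateau n t) (\<phi> res w) = \<phi> (plateau n) w - \<i> *\<^sub>C \<phi> (plateau n) (\<phi> res w)"
    by (simp only: \<pi>_mult \<pi>_diff \<pi>_cmult C0_mult C0_cmult res_C0 plateau_C0 plateau_mult_C0)
  then show ?thesis
    unfolding z by (simp add: \<pi>_diff_right \<pi>_scaleC_right plateau_C0 y[symmetric])
qed

lemma generator_res:
  assumes "w \<in> essential"
  shows "generator (\<phi> res w) = Some (w - \<i> *\<^sub>C \<phi> res w)"
  using assms submodule_essential
  by (simp add: generator_iff \<phi>_essential res_C0 submodule_diff submodule_scaleC)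

lemma generator_cnj_res:
  assumes "w \<in> essential"
  shows "generator (\<phi> (\<lambda>t. cnj (res t)) w) = Some (w + \<i> *\<^sub>C \<phi> (\<lambda>t. cnj (res t)) w)"
  using assms submodule_essential
  by (simp add: generator_iff_cnj \<phi>_essential cnj_res_C0 submodule_add submodule_scaleC)

section \<open>Regularity and self-adjointness of the generator\<close>

lemma densely_defined_generator: "densely_defined essential generator"
  unfolding densely_defined_def
proof
  fix x assume x: "x \<in> essential"
  \<comment> \<open>Multiplication by \<open>t\<close> keeps \<open>plateau n\<close> in
    \<open>C0\<close>, so the approximants of \<open>x\<close> lie in the domain.\<close>
  have "\<phi> (plateau n) x \<in> dom generator" for n
    using generator_\<phi>[OF plateau_C0 plateau_mult_C0] by auto
  with essential_tendsto[OF x] show "x \<in> closure (dom generator)"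
    unfolding closure_sequential by (intro exI[of _ "\<lambda>n. \<phi> (plateau n) x"] conjI allI)
qed

lemma generator_add:
  "generator x = Some a \<Longrightarrow> generator y = Some b \<Longrightarrow> generator (x + y) = Some (a + b)"
proof -
  assume "generator x = Some a" "generator y = Some b"
  then have *: "x \<in> essential" "a \<in> essential" "y \<in> essential" "b \<in> essential"
    "x = \<phi> res (a + \<i> *\<^sub>C x)" "y = \<phi> res (b + \<i> *\<^sub>C y)" by (auto simp: generator_iff)
  have "x + y = \<phi> res (a + \<i> *\<^sub>C x) + \<phi> res (b + \<i> *\<^sub>C y)" using *(5,6) by simp
  also have "\<dots> = \<phi> res (a + b + \<i> *\<^sub>C (x + y))"
    by (simp add: \<pi>_add_right[symmetric] res_C0 scaleC_add_right algebra_simps)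
  finally show ?thesis using * by (simp add: generator_iff submodule_add submodule_essential)
qed

lemma generator_scaleC:
  "generator x = Some a \<Longrightarrow> generator (c *\<^sub>C x) = Some (c *\<^sub>C a)"
proof -
  assume "generator x = Some a"
  then have *: "x \<in> essential" "a \<in> essential" "x = \<phi> res (a + \<i> *\<^sub>C x)" by (auto simp: generator_iff)
  have "c *\<^sub>C x = c *\<^sub>C \<phi> res (a + \<i> *\<^sub>C x)" using *(3) by simp
  also have "\<dots> = \<phi> res (c *\<^sub>C a + \<i> *\<^sub>C c *\<^sub>C x)"
    by (simp add: \<pi>_scaleC_right[symmetric] res_C0 scaleC_add_right scaleC_scaleC mult.commute)
  finally show ?thesis using * by (simp add: generator_iff submodule_scaleC submodule_essential)
qed

lemma generator_act:
  "generator x = Some a \<Longrightarrow> generator (x \<cdot> b) = Some (a \<cdot> b)"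
proof -
  assume "generator x = Some a"
  then have *: "x \<in> essential" "a \<in> essential" "x = \<phi> res (a + \<i> *\<^sub>C x)" by (auto simp: generator_iff)
  have "x \<cdot> b = \<phi> res (a + \<i> *\<^sub>C x) \<cdot> b" using *(3) by simp
  also have "\<dots> = \<phi> res (a \<cdot> b + \<i> *\<^sub>C (x \<cdot> b))"
    by (simp add: \<pi>_act[symmetric] res_C0 act_add_left act_scaleC_left)
  finally show ?thesis using * by (simp add: generator_iff submodule_act submodule_essential)
qed

lemma module_map_generator: "module_map essential generator"
proof -
  have "generator 0 = Some 0"
    using generator_\<phi>[OF plateau_C0 plateau_mult_C0, of _ 0] plateau_C0 plateau_mult_C0
    by (simp add: bounded_linear_\<phi> bounded_linear.linear[THEN linear_0])
  then have "submodule (dom generator)"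
    unfolding submodule_def csubspace_def
    by (auto simp: dom_def dest: generator_add generator_scaleC generator_act)
  moreover have "dom generator \<subseteq> essential" "ran generator \<subseteq> essential"
    by (auto simp: generator_iff ran_def)
  ultimately show ?thesis
    unfolding module_map_def by (auto simp: generator_add generator_scaleC generator_act)
qed

text \<open>The graph is the solution set of an equation between continuous maps, within the closed
  set of pairs from \<open>essential\<close>.\<close>

lemma closed_graph_generator: "closed (Map.graph generator)"
proof -
  have "Map.graph generator = (fst -` essential \<inter> snd -` essential) \<inter>
      {p. fst p = \<phi> res (snd p + \<i> *\<^sub>C fst p)}"
    by (auto simp: Map.graph_def generator_iff)
  moreover have "continuous_on UNIV (\<lambda>p. \<phi> res (snd p + \<i> *\<^sub>C fst p))"
    by (intro bounded_linear.continuous_on[OF bounded_linear_\<phi>[OF res_C0]]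
        bounded_linear.continuous_on[OF bounded_linear_scaleC] continuous_intros)
  ultimately show ?thesis
    by (simp add: closed_Int closed_vimage_fst closed_vimage_snd closed_essential
        closed_Collect_eq continuous_on_fst continuous_on_id)
qed

text \<open>Testing the adjoint relation on vectors \<open>\<phi> res w\<close> moves
  \<open>res\<close> to the other side as its conjugate, which yields the second resolvent equation
  for \<open>y\<close>. The converse runs the same computation backwards.\<close>

lemma adjoint_generator_iff:
  "y \<in> essential \<and> z \<in> essential \<and> (\<forall>x\<in>dom generator. \<langle>the (generator x), y\<rangle> = \<langle>x, z\<rangle>)
    \<longleftrightarrow> generator y = Some z"
proof safe
  assume y: "y \<in> essential" and z: "z \<in> essential"
    and adj: "\<forall>x\<in>dom generator. \<langle>the (generator x), y\<rangle> = \<langle>x, z\<rangle>"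
  have "y = \<phi> (\<lambda>t. cnj (res t)) (z - \<i> *\<^sub>C y)"
  proof (rule ip_eq_on_submodule[OF submodule_essential y])
    show "\<phi> (\<lambda>t. cnj (res t)) (z - \<i> *\<^sub>C y) \<in> essential" by (intro \<phi>_essential cnj_res_C0)
    fix w assume w: "w \<in> essential"
    have "\<langle>w - \<i> *\<^sub>C \<phi> res w, y\<rangle> = \<langle>\<phi> res w, z\<rangle>"
      using adj generator_res[OF w] by (metis domI option.sel)
    then have "\<langle>w, y\<rangle> = \<langle>\<phi> res w, z - \<i> *\<^sub>C y\<rangle>"
      by (simp add: ip_diff_left ip_diff_right ip_scaleC_left ip_scaleC_right scaleC_minus_left
          algebra_simps eq_diff_eq)
    then show "\<langle>w, y\<rangle> = \<langle>w, \<phi> (\<lambda>t. cnj (res t)) (z - \<i> *\<^sub>C y)\<rangle>" by (simp add: \<pi>_ip res_C0)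
  qed
  with y z show "generator y = Some z" by (simp add: generator_iff_cnj)
next
  fix x a assume y: "generator y = Some z" and x: "generator x = Some a"
  have "\<langle>x, z - \<i> *\<^sub>C y\<rangle> = \<langle>\<phi> res (a + \<i> *\<^sub>C x), z - \<i> *\<^sub>C y\<rangle>"
    using x by (simp add: generator_iff)
  also have "\<dots> = \<langle>a + \<i> *\<^sub>C x, \<phi> (\<lambda>t. cnj (res t)) (z - \<i> *\<^sub>C y)\<rangle>" by (simp add: \<pi>_ip res_C0)
  also have "\<dots> = \<langle>a + \<i> *\<^sub>C x, y\<rangle>" using y by (simp add: generator_iff_cnj)
  finally show "\<langle>the (generator x), y\<rangle> = \<langle>x, z\<rangle>"
    using x by (simp add: ip_add_left ip_diff_right ip_scaleC_left ip_scaleC_right scaleC_minus_left)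
qed (auto simp: generator_iff)

lemma self_adjoint_generator: "self_adjoint essential generator"
  unfolding self_adjoint_def
proof
  fix y
  show "unbounded_adjoint essential generator y = generator y"
  proof (cases "generator y")
    case None
    then show ?thesis
      using adjoint_generator_iff[of y] by (auto simp: unbounded_adjoint_def)
  next
    case (Some z)
    then have y: "y \<in> essential" and ex: "\<exists>z\<in>essential. \<forall>x\<in>dom generator. \<langle>the (generator x), y\<rangle> = \<langle>x, z\<rangle>"
      using adjoint_generator_iff[of y z] by auto
    have "(THE z. z \<in> essential \<and> (\<forall>x\<in>dom generator. \<langle>the (generator x), y\<rangle> = \<langle>x, z\<rangle>)) = z"
    proof (rule the_equality)
      show "z \<in> essential \<and> (\<forall>x\<in>dom generator. \<langle>the (generator x), y\<rangle> = \<langle>x, z\<rangle>)"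
        using Some adjoint_generator_iff[of y z] by blast
      fix w assume "w \<in> essential \<and> (\<forall>x\<in>dom generator. \<langle>the (generator x), y\<rangle> = \<langle>x, w\<rangle>)"
      then have "generator y = Some w" using adjoint_generator_iff[of y w] y by blast
      with Some show "w = z" by simp
    qed
    then show ?thesis using y ex Some unfolding unbounded_adjoint_def by simp
  qed
qed

text \<open>Density of the range of \<open>1 + D\<^sup>2\<close> holds because it contains every
  \<open>\<phi> (plateau n) x\<close>, and these approximate \<open>x\<close>.\<close>

lemma regular_generator: "regular essential generator"
proof -
  have adj: "unbounded_adjoint essential generator = generator"
    using self_adjoint_generator by (simp add: self_adjoint_def)
  have "x \<in> closure {x + z |x y z. generator x = Some y \<and> generator y = Some z}"
    if x: "x \<in> essential" for x
  proof -
    have "\<phi> (plateau n) x \<in> {x + z |x y z. generator x = Some y \<and> generator y = Some z}" for n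
    proof -
      \<comment> \<open>This is \<open>plateau n\<close> divided by \<open>1 + t\<^sup>2\<close>, so
        that \<open>(1 + D\<^sup>2) (\<phi> f x) = \<phi> (plateau n) x\<close>. The plateau factor
        keeps \<open>t\<^sup>2 f\<close> in \<open>C0\<close>.\<close>
      define f where "f t = plateau n t * (res t * cnj (res t))" for t
      have f: "f \<in> C0"
        unfolding f_def by (intro C0_mult plateau_C0 res_C0 cnj_res_C0)
      have "(\<lambda>t. (complex_of_real t * plateau n t) * (res t * cnj (res t))) \<in> C0"
        by (intro C0_mult plateau_mult_C0 res_C0 cnj_res_C0)
      then have tf: "(\<lambda>t. complex_of_real t * f t) \<in> C0" by (simp add: f_def mult.assoc)
      have eq: "complex_of_real t * (complex_of_real t * f t) = plateau n t - f t" for t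
      proof -
        have "complex_of_real t * cnj (res t) = 1 + \<i> * cnj (res t)"
          using arg_cong[OF mult_res[of t], of cnj] by simp
        moreover have "complex_of_real t * (complex_of_real t * f t)
          = plateau n t * ((complex_of_real t * res t) * (complex_of_real t * cnj (res t)))"
          by (simp add: f_def mult_ac)
        ultimately have "complex_of_real t * (complex_of_real t * f t)
          = plateau n t * (1 + \<i> * (cnj (res t) - res t) + res t * cnj (res t))"
          unfolding mult_res by (simp add: algebra_simps)
        then show ?thesis unfolding cnj_res_mult_res[symmetric] by (simp add: f_def algebra_simps)
      qed
      then have ttf: "(\<lambda>t. complex_of_real t * (complex_of_real t * f t)) \<in> C0"
        using f plateau_C0 by (simp add: C0_diff)
      have "\<phi> (plateau n) x = \<phi> f x + \<phi> (\<lambda>t. complex_of_real t * (complex_of_real t * f t)) x"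
        using f plateau_C0 unfolding eq by (simp add: \<pi>_diff)
      with generator_\<phi>[OF f tf, of x] generator_\<phi>[OF tf ttf, of x] show ?thesis by blast
    qed
    with essential_tendsto[OF x] show ?thesis unfolding closure_sequential by (intro exI[of _ "\<lambda>n. \<phi> (plateau n) x"] conjI allI)
  qed
  then show ?thesis
    unfolding regular_def adj
    by (auto simp: module_map_generator densely_defined_generator closed_graph_generator)
qed

section \<open>Resolvents and functional calculus of the generator\<close>

lemma resolvent_generator:
  "resolvent essential generator \<i> = restriction res"
  "resolvent essential generator (- \<i>) = restriction (\<lambda>t. cnj (res t))"
proof -
  have "(THE x. x \<in> dom generator \<and> the (generator x) + \<i> *\<^sub>C x = y) = \<phi> res y"
    if y: "y \<in> essential" for y
  proof (rule the_equality)
    show "\<phi> res y \<in> dom generator \<and> the (generator (\<phi> res y)) + \<i> *\<^sub>C \<phi> res y = y"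
      using generator_res[OF y] by (simp add: domI scaleC_minus_left)
    fix x assume "x \<in> dom generator \<and> the (generator x) + \<i> *\<^sub>C x = y"
    then obtain z where z: "generator x = Some z" "z + \<i> *\<^sub>C x = y" by auto
    then show "x = \<phi> res y" using generator_iff[of x z] by (simp add: scaleC_minus_left)
  qed
  then show "resolvent essential generator \<i> = restriction res"
    by (auto simp: resolvent_def restriction_def)
  have "(THE x. x \<in> dom generator \<and> the (generator x) + (- \<i>) *\<^sub>C x = y) = \<phi> (\<lambda>t. cnj (res t)) y"
    if y: "y \<in> essential" for y
  proof (rule the_equality)
    show "\<phi> (\<lambda>t. cnj (res t)) y \<in> dom generator \<and> the (generator (\<phi> (\<lambda>t. cnj (res t)) y)) + (- \<i>) *\<^sub>C \<phi> (\<lambda>t. cnj (res t)) y = y"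
      using generator_cnj_res[OF y] by (simp add: domI scaleC_minus_left)
    fix x assume "x \<in> dom generator \<and> the (generator x) + (- \<i>) *\<^sub>C x = y"
    then obtain z where z: "generator x = Some z" "z + (- \<i>) *\<^sub>C x = y" by auto
    then show "x = \<phi> (\<lambda>t. cnj (res t)) y" using generator_iff_cnj[of x z] by (simp add: scaleC_minus_left)
  qed
  then show "resolvent essential generator (- \<i>) = restriction (\<lambda>t. cnj (res t))"
    by (auto simp: resolvent_def restriction_def)
qed

text \<open>The restriction takes the prescribed values at both resolvent functions, and a
  representation is determined by these values, so the definite description is justified.\<close>

lemma functional_calculus_generator:
  assumes f: "f \<in> C0"
  shows "functional_calculus essential generator f = restriction f"
proof -
  have res: "(\<lambda>t. 1 / (complex_of_real t + \<i>)) = res" "(\<lambda>t. 1 / (complex_of_real t - \<i>)) = (\<lambda>t. cnj (res t))"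
    by (auto simp: res_def)
  have "is_functional_calculus essential generator restriction"
    unfolding is_functional_calculus_def res by (simp add: resolvent_generator C0_star_hom_restriction)
  moreover have "\<pi> f = restriction f" if "is_functional_calculus essential generator \<pi>" for \<pi>
  proof (rule C0_representation_unique[OF _ C0_representation_restriction])
    show "C0_representation act ip essential \<pi>"
      using that submodule_essential by unfold_locales (auto simp: is_functional_calculus_def)
  qed (use that f in \<open>auto simp: is_functional_calculus_def res resolvent_generator\<close>)
  ultimately show ?thesis
    unfolding functional_calculus_def by (intro the_equality) blast+
qed

section \<open>Strict and nondegenerate representations\<close>

lemma strict_decomposition:
  assumes "strict \<phi>"
  shows "\<exists>e\<in>essential. \<exists>p\<in>orthogonal_complement essential. x = e + p"
proof -
  obtain F where F: "C0_approximate_unit F" and "cauchy_filter (filtermap (\<lambda>u. \<phi> u x) F)"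
    using assms unfolding strict_def by blast
  have nb: "F \<noteq> bot" and C0: "\<forall>\<^sub>F u in F. u \<in> C0"
    and lim: "\<And>f. f \<in> C0 \<Longrightarrow> uniform_limit UNIV (\<lambda>u t. u t * f t) f F"
    using F by (auto simp: C0_approximate_unit_def elim: eventually_mono)
  have "\<exists>c. filtermap (\<lambda>u. \<phi> u x) F \<le> nhds c"
    using \<open>cauchy_filter _\<close> nb
    by (intro cauchy_filter_complete_converges[of _ UNIV, OF _ complete_UNIV]) (auto simp: filtermap_bot_iff)
  then obtain c where c: "((\<lambda>u. \<phi> u x) \<longlongrightarrow> c) F" by (auto simp: filterlim_def)
  have "c \<in> essential"
    using C0 by (intro Lim_in_closed_set[OF closed_essential _ nb c]) (auto elim: eventually_mono simp: \<phi>_essential)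
  moreover have "x - c \<in> orthogonal_complement essential"
  proof -
    \<comment> \<open>The limit of \<open>\<phi> f (\<phi> u x)\<close> is computed twice: as
      \<open>\<phi> f x\<close>, since \<open>u\<close> is an approximate unit, and as
      \<open>\<phi> f c\<close>, by continuity of \<open>\<phi> f\<close>.\<close>
    have 0: "\<phi> f (x - c) = 0" if f: "f \<in> C0" for f
    proof -
      have "((\<lambda>u. \<phi> (\<lambda>t. u t * f t) x) \<longlongrightarrow> \<phi> f x) F"
        using C0 f by (intro tendsto_\<pi>[OF lim]) (auto elim: eventually_mono simp: C0_mult)
      moreover have "\<forall>\<^sub>F u in F. \<phi> (\<lambda>t. u t * f t) x = \<phi> f (\<phi> u x)"
        using C0
      proof eventually_elim
        case (elim u)
        then have "\<phi> (\<lambda>t. f t * u t) x = \<phi> f (\<phi> u x)" using f by (intro \<pi>_mult)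
        then show ?case by (simp only: mult.commute)
      qed
      ultimately have "((\<lambda>u. \<phi> f (\<phi> u x)) \<longlongrightarrow> \<phi> f x) F" by (rule Lim_transform_eventually)
      moreover have "((\<lambda>u. \<phi> f (\<phi> u x)) \<longlongrightarrow> \<phi> f c) F" by (rule tendsto_\<phi>[OF f c])
      ultimately have "\<phi> f x = \<phi> f c" using tendsto_unique[OF nb] by blast
      then show ?thesis using f by (simp add: \<pi>_diff_right)
    qed
    \<comment> \<open>Approximate \<open>y\<close> by \<open>\<phi> (plateau n) y\<close> and move
      the self-adjoint operator onto \<open>x - c\<close>, which it kills.\<close>
    have "\<langle>y, x - c\<rangle> = 0" if y: "y \<in> essential" for y
    proof -
      have "(\<lambda>n. \<langle>\<phi> (plateau n) y, x - c\<rangle>) \<longlonglongrightarrow> \<langle>y, x - c\<rangle>"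
        by (intro tendsto_ip essential_tendsto[OF y] tendsto_const)
      moreover have "\<langle>\<phi> (plateau n) y, x - c\<rangle> = 0" for n
        by (simp add: \<pi>_ip plateau_C0 0)
      ultimately show ?thesis by (simp add: LIMSEQ_const_iff)
    qed
    then show ?thesis by (simp add: orthogonal_complement_def)
  qed
  ultimately show ?thesis by (metis add.commute diff_add_cancel)
qed

text \<open>Both sides agree on \<open>essential\<close>, and \<open>\<phi> f\<close> vanishes on
  the complement: the inner square of \<open>\<phi> f p\<close> pairs an essential vector with
  \<open>p\<close>.\<close>

lemma strict_extend_by_zero:
  assumes strict: "strict \<phi>" and f: "f \<in> C0"
  shows "\<phi> f = extend_by_zero essential (restriction f)"
proof
  fix x
  obtain e p where e: "e \<in> essential" and p: "p \<in> orthogonal_complement essential" and x: "x = e + p"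
    using strict_decomposition[OF strict] by blast
  have "(THE e. e \<in> essential \<and> x - e \<in> orthogonal_complement essential) = e"
  proof (rule the_equality)
    show "e \<in> essential \<and> x - e \<in> orthogonal_complement essential" using e p x by simp
    fix e' assume e': "e' \<in> essential \<and> x - e' \<in> orthogonal_complement essential"
    show "e' = e"
    proof (rule ip_eq_on_submodule[OF submodule_essential])
      fix y assume y: "y \<in> essential"
      have "\<langle>y, x - e'\<rangle> = 0" "\<langle>y, x - e\<rangle> = 0" using y e' p x by (auto simp: orthogonal_complement_def)
      then show "\<langle>y, e'\<rangle> = \<langle>y, e\<rangle>" by (simp add: ip_diff_right)
    qed (use e e' in auto)
  qed
  moreover have "\<phi> f p = 0"
  proof (rule ip_self_eq_0D)
    have "\<langle>\<phi> f p, \<phi> f p\<rangle> = \<langle>\<phi> (\<lambda>t. cnj (f t)) (\<phi> f p), p\<rangle>"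
      using f by (simp add: \<pi>_ip C0_cnj)
    also have "\<dots> = 0"
      using p \<phi>_essential[OF C0_cnj[OF f]] by (simp add: orthogonal_complement_def)
    finally show "\<langle>\<phi> f p, \<phi> f p\<rangle> = 0" .
  qed
  ultimately show "\<phi> f x = extend_by_zero essential (restriction f) x"
    using e f by (simp add: extend_by_zero_def restriction_def) (simp add: x \<pi>_add_right)
qed

lemma nondegenerate_essential:
  assumes "nondegenerate \<phi>" shows "essential = UNIV"
proof -
  have "span {\<phi> f x |f x. f \<in> C0} \<subseteq> essential"
    using \<phi>_essential csubspace_subspace[OF submodule_csubspace[OF submodule_essential]]
    by (intro span_minimal) auto
  then have "closure (span {\<phi> f x |f x. f \<in> C0}) \<subseteq> essential"
    using closed_essential by (rule closure_minimal)
  then show ?thesis using assms by (auto simp: nondegenerate_def)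
qed

text \<open>The finite rank approximation \<open>S\<close> of \<open>\<phi> f\<close> is cut down to \<open>\<phi> u S \<phi> u\<close> with \<open>u\<close> a
  plateau function, which has finite rank over the essential submodule.\<close>

lemma compact_restriction:
  assumes f: "f \<in> C0" and compact: "\<phi> f \<in> compact_operators UNIV"
  shows "restriction f \<in> compact_operators essential"
proof -
  have "\<exists>S\<in>finite_rank essential. \<forall>z\<in>essential. norm (restriction f z - S z) \<le> e * norm z"
    if e: "e > 0" for e
  proof -
    \<comment> \<open>Two errors of size \<open>4 * d\<close> will add up to
      \<open>e\<close>.\<close>
    define d where "d = e / 8"
    have d: "d > 0" using e by (simp add: d_def)
    obtain S where S: "S \<in> finite_rank UNIV" "\<And>z. norm (\<phi> f z - S z) \<le> d * norm z"
      using compact d by (auto simp: compact_operators_def)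
    obtain N u v where N: "S = (\<lambda>z. \<Sum>i<(N::nat). u i \<cdot> \<langle>v i, z\<rangle>)"
      using S(1) by (auto simp: finite_rank_def)
    have "\<forall>\<^sub>F n in sequentially. \<forall>t\<in>UNIV. dist (plateau n t * f t) (f t) < d"
      by (rule uniform_limitD[OF uniform_limit_plateau[OF f] d])
    then obtain n where n: "\<And>t. norm (f t - plateau n t * f t) < d"
      by (auto simp: eventually_sequentially dist_norm norm_minus_commute)
    let ?u = "plateau n"
    \<comment> \<open>The outer factor passes to the vectors \<open>u i\<close> by module linearity,
      the inner one to \<open>v i\<close> because a plateau function is real.\<close>
    have "(\<lambda>z. \<phi> ?u (S (\<phi> ?u z))) = (\<lambda>z. \<Sum>i<N. \<phi> ?u (u i) \<cdot> \<langle>\<phi> ?u (v i), z\<rangle>)"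
      by (simp add: N linear_sum[OF bounded_linear.linear[OF bounded_linear_\<phi>[OF plateau_C0]]]
          \<pi>_act plateau_C0 \<pi>_ip)
    then have "(\<lambda>z. \<phi> ?u (S (\<phi> ?u z))) \<in> finite_rank essential"
      unfolding finite_rank_def mem_Collect_eq
      by (intro exI[of _ N] exI[of _ "\<lambda>i. \<phi> ?u (u i)"] exI[of _ "\<lambda>i. \<phi> ?u (v i)"] conjI)
        (simp_all add: \<phi>_essential plateau_C0)
    moreover have "norm (restriction f z - \<phi> ?u (S (\<phi> ?u z))) \<le> e * norm z" if z: "z \<in> essential" for z
    proof -
      \<comment> \<open>First error, from replacing \<open>f\<close> by \<open>?u * f * ?u\<close>:
        the functions differ by at most \<open>2 * d\<close>, and \<open>\<phi>\<close> costs
        another factor 2.\<close>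
      have g: "(\<lambda>t. ?u t * (f t * ?u t)) \<in> C0" by (intro C0_mult plateau_C0 f)
      have "norm (f t - ?u t * (f t * ?u t)) \<le> 2 * d" for t
      proof -
        have "f t - ?u t * (f t * ?u t) = (f t - ?u t * f t) + ?u t * (f t - ?u t * f t)"
          by (simp add: algebra_simps)
        then have "norm (f t - ?u t * (f t * ?u t)) \<le> norm (f t - ?u t * f t) + norm (?u t) * norm (f t - ?u t * f t)"
          by (metis norm_mult norm_triangle_ineq)
        also have "\<dots> \<le> d + 1 * d"
          using n[of t] norm_plateau_le[of n t] by (intro add_mono mult_mono) auto
        finally show ?thesis by simp
      qed
      then have "norm (\<phi> (\<lambda>t. f t - ?u t * (f t * ?u t)) z) \<le> 2 * (2 * d) * norm z"
        using d by (intro norm_\<pi>_le C0_diff f g) auto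
      then have 1: "norm (\<phi> f z - \<phi> ?u (\<phi> f (\<phi> ?u z))) \<le> 4 * d * norm z"
        using f g by (simp add: \<pi>_diff \<pi>_mult C0_mult plateau_C0)
      \<comment> \<open>Second error, from replacing \<open>\<phi> f\<close> by \<open>S\<close> in
        the middle: each outer factor contributes 2.\<close>
      have "norm (\<phi> ?u (\<phi> f (\<phi> ?u z) - S (\<phi> ?u z))) \<le> 2 * norm (\<phi> f (\<phi> ?u z) - S (\<phi> ?u z))"
        by (rule norm_\<phi>_plateau_le)
      also have "\<dots> \<le> 2 * (d * norm (\<phi> ?u z))" using S(2) by (intro mult_left_mono) auto
      also have "\<dots> \<le> 2 * (d * (2 * norm z))"
        using d norm_\<phi>_plateau_le by (intro mult_left_mono) auto
      finally have 2: "norm (\<phi> ?u (\<phi> f (\<phi> ?u z)) - \<phi> ?u (S (\<phi> ?u z))) \<le> 4 * d * norm z"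
        by (simp add: \<pi>_diff_right plateau_C0)
      have "norm (\<phi> f z - \<phi> ?u (S (\<phi> ?u z))) \<le> 4 * d * norm z + 4 * d * norm z"
        using norm_diff_triangle_le[OF 1 2] .
      then show ?thesis using z by (simp add: restriction_def d_def)
    qed
    ultimately show ?thesis by (intro bexI[of _ "\<lambda>z. \<phi> ?u (S (\<phi> ?u z))"] ballI)
  qed
  then show ?thesis using restriction_adjointable[OF f] by (simp add: compact_operators_def)
qed

section \<open>Compatibility of the generator and its module with the grading\<close>

lemma degree_one_generator:
  assumes closed: "\<And>n. closed (H n)" and graded: "graded_map H \<phi>"
  shows "degree_one H generator"
  unfolding degree_one_def
proof (intro allI ballI)
  fix m x assume "x \<in> dom generator \<inter> H m"
  then obtain z where x: "x \<in> H m" and z: "generator x = Some z" by auto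
  \<comment> \<open>Applying these odd functions to \<open>x\<close> gives
    \<open>\<phi> (plateau n) z\<close>, which therefore has degree \<open>m + 1\<close>; closedness
    of \<open>H (m + 1)\<close> passes this to the limit \<open>z\<close>.\<close>
  have odd: "(\<lambda>t. complex_of_real t * plateau n t) \<in> C0_degree 1" for n
    using plateau_mult_C0 by (simp add: C0_degree_def plateau_even)
  have "z \<in> H (m + 1)"
  proof (rule closed_sequentially[OF closed])
    show "\<phi> (plateau n) z \<in> H (m + 1)" for n
      using graded odd x \<phi>_plateau_generator[OF z, of n] unfolding graded_map_def by metis
    show "(\<lambda>n. \<phi> (plateau n) z) \<longlonglongrightarrow> z" using z by (simp add: generator_iff essential_tendsto)
  qed
  with z show "the (generator x) \<in> H (m + 1)" by simp
qed

text \<open>Plateau functions are even, so \<open>\<phi> (plateau n)\<close> acts on the homogeneous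
  parts separately. The bound for the even part turns convergence at \<open>x\<close> into
  convergence at \<open>y\<close>, and \<open>z\<close> is the difference.\<close>

lemma graded_subspace_essential:
  assumes "graded_hilbert_module \<beta> act ip H" and graded: "graded_map H \<phi>"
  shows "graded_subspace H essential"
  unfolding graded_subspace_def
proof
  interpret graded_hilbert_module \<beta> act ip H by fact
  fix x assume x: "x \<in> essential"
  obtain y z where y: "y \<in> H 0" and z: "z \<in> H 1" and xyz: "x = y + z" using H_sum by blast
  have even: "plateau n \<in> C0_degree 0" for n
    using plateau_C0 by (simp add: C0_degree_def plateau_even)
  have "\<phi> (plateau n) y \<in> H (0 + 0)" "\<phi> (plateau n) z \<in> H (1 + 0)" for n
    using graded even y z unfolding graded_map_def by blast+
  then have yz: "\<phi> (plateau n) y - y \<in> H 0" "\<phi> (plateau n) z - z \<in> H 1" for n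
    using y z csubspace_diff[OF csubspace_H] by simp_all
  have "norm (\<phi> (plateau n) y - y) \<le> 2 * norm (\<phi> (plateau n) x - x)" for n
    using norm_even_part_le[OF yz, of n n] by (simp add: xyz \<pi>_add_right plateau_C0 algebra_simps)
  moreover have "(\<lambda>n. 2 * norm (\<phi> (plateau n) x - x)) \<longlonglongrightarrow> 0"
    by (rule tendsto_mult_right_zero[OF tendsto_norm_zero[OF LIM_zero[OF essential_tendsto[OF x]]]])
  ultimately have "(\<lambda>n. \<phi> (plateau n) y - y) \<longlonglongrightarrow> 0"
    by (rule Lim_null_comparison[OF always_eventually[OF allI]])
  then have "y \<in> essential" by (simp add: essential_def LIM_zero_iff)
  moreover have "z \<in> essential"
    using submodule_diff[OF submodule_essential x \<open>y \<in> essential\<close>] by (simp add: xyz)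
  ultimately show "\<exists>y\<in>essential \<inter> H 0. \<exists>z\<in>essential \<inter> H 1. x = y + z" using y z xyz by blast
qed

end

theorem theorem3p2:
  fixes \<beta> :: "'b::cstar_algebra \<Rightarrow> 'b"
    and act :: "'h::complex_banach \<Rightarrow> 'b \<Rightarrow> 'h"
    and ip :: "'h \<Rightarrow> 'h \<Rightarrow> 'b"
    and H :: "2 \<Rightarrow> 'h set"
    and \<phi> :: "(real \<Rightarrow> complex) \<Rightarrow> 'h \<Rightarrow> 'h"
  assumes "graded_hilbert_module \<beta> act ip H"
    and "hilbert_module.C0_star_hom act ip UNIV \<phi>"
    and "graded_map H \<phi>"
  shows "\<exists>(E :: 'h set) (D :: 'h \<rightharpoonup> 'h).
    closed E \<and> hilbert_module.submodule act E \<and> graded_subspace H E \<and>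
    (\<forall>f\<in>C0. \<forall>x\<in>E. \<phi> f x \<in> E) \<and>
    hilbert_module.regular act ip E D \<and> hilbert_module.self_adjoint ip E D \<and>
    degree_one H D \<and>
    (\<forall>f\<in>C0. \<forall>x\<in>E. \<phi> f x = hilbert_module.functional_calculus act ip E D f x) \<and>
    (hilbert_module.strict ip \<phi> \<longrightarrow>
       hilbert_module.complemented ip E \<and>
       (\<forall>f\<in>C0. hilbert_module.functional_calculus act ip E D f \<in> hilbert_module.adjointable act ip E \<and>
          \<phi> f = hilbert_module.extend_by_zero ip E (hilbert_module.functional_calculus act ip E D f))) \<and>
    (hilbert_module.nondegenerate \<phi> \<longrightarrow> E = UNIV) \<and>
    ((\<forall>f\<in>C0. \<phi> f \<in> hilbert_module.compact_operators act ip UNIV) \<longrightarrow>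
       hilbert_module.compact_resolvents act ip E D)"
proof -
  interpret graded_hilbert_module \<beta> act ip H by fact
  interpret C0_action act ip \<phi>
    by unfold_locales (rule submodule_UNIV assms(2))+
  show ?thesis
  proof (intro exI conjI impI)
    show "closed essential" by (rule closed_essential)
    show "submodule essential" by (rule submodule_essential)
    show "graded_subspace H essential" by (rule graded_subspace_essential[OF assms(1,3)])
    show "\<forall>f\<in>C0. \<forall>x\<in>essential. \<phi> f x \<in> essential" by (simp add: \<phi>_essential)
    show "regular essential generator" by (rule regular_generator)
    show "self_adjoint essential generator" by (rule self_adjoint_generator)
    show "degree_one H generator" by (rule degree_one_generator[OF closed_H assms(3)])
    show "\<forall>f\<in>C0. \<forall>x\<in>essential. \<phi> f x = functional_calculus essential generator f x"
      by (simp add: functional_calculus_generator restriction_def)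
    show "complemented essential" if "strict \<phi>"
      using strict_decomposition[OF that] by (simp add: complemented_def)
    show "\<forall>f\<in>C0. functional_calculus essential generator f \<in> adjointable essential \<and>
        \<phi> f = extend_by_zero essential (functional_calculus essential generator f)" if "strict \<phi>"
      using strict_extend_by_zero[OF that] by (simp add: functional_calculus_generator restriction_adjointable)
    show "essential = UNIV" if "nondegenerate \<phi>" using that by (rule nondegenerate_essential)
    show "compact_resolvents essential generator"
      if "\<forall>f\<in>C0. \<phi> f \<in> compact_operators UNIV"
      using that by (simp add: compact_resolvents_def resolvent_generator compact_restriction res_C0 cnj_res_C0)
  qed
qed

end
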